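(* Let $\{X_t\}_{t\ge 0}$ be a semi-Lévy process on $\mathbb{R}^d$ with period $p>0$. Then the following hold. (i) If $\{X_t\}_{t\ge 0}$ is $0$-recurrent, then it is recurrent. (ii) $\{X_t\}_{t\ge 0}$ is either recurrent or transient. (iii) $\{X_t\}_{t\ge 0}$ is recurrent if and only if $\int_0^\infty P(X_t\in B_a)\,dt=\infty$ for every $a>0$. (iv) $\{X_t\}_{t\ge 0}$ is recurrent if and only if, for every $a>0$, $\int_0^\infty \mathbf{1}_{B_a}(X_t)\,dt=\infty$ almost surely. (v) $\{X_t\}_{t\ge 0}$ is transient if and only if $\int_0^\infty P(X_t\in B_a)\,dt<\infty$ for every $a>0$. (vi) $\{X_t\}_{t\ge 0}$ is transient if and only if, for every $a>0$, $\int_0^\infty \mathbf{1}_{B_a}(X_t)\,dt<\infty$ almost surely. (vii) Fix $h\in(0,\infty)\cap p\mathbb{Q}$ arbitrarily. Then $\{X_t\}_{t\ge 0}$ is recurrent if and only if the sequence $\{X_{nh}\}_{n\in\mathbb{Z}_+}$ is recurrent.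
   Context: An additive process on $\mathbb{R}^d$ is an $\mathbb{R}^d$-valued stochastic process $\{X_t\}_{t\ge 0}$ with $X_0=0$ a.s. that is stochastically continuous, has independent increments, and has sample paths that are right-continuous in $t\ge 0$ with left limits in $t>0$. A semi-Lévy process with period $p>0$ is an additive process such that $X_{t+p}-X_{s+p}$ and $X_t-X_s$ have the same distribution for all $s,t\ge 0$. For $s\ge 0$, an additive process $\{X_t\}_{t\ge0}$ is $s$-recurrent if $\liminf_{t\to\infty}|X_t-X_s|=0$ a.s.; it is recurrent if it is $s$-recurrent for every $s\ge 0$; it is transient if $\lim_{t\to\infty}|X_t|=\infty$ a.s. A sequence $\{S_n\}_{n\in\mathbb{Z}_+}$ of $\mathbb{R}^d$-valued random variables (here $S_n=X_{nh}$, a so-called semi-random walk) is recurrent if $\liminf_{n\to\infty}|S_n-S_m|=0$ a.s. for every $m\in\mathbb{Z}_+$. Notation: $\mathbb{Z}_+$ is the set of nonnegative integers, $p\mathbb{Q}=\{pr : r\in\mathbb{Q}\}$, $|x|$ is the Euclidean norm, $B_a=\{x\in\mathbb{R}^d: |x|<a\}$, and $\mathbf{1}_B$ is the indicator function of $B$. *)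

theory Defs
  imports "HOL-Probability.Probability"
begin

text \<open>
  The time parameter is real; only the variables \<open>X t\<close> with \<open>t \<ge> 0\<close> are constrained.
\<close>

locale additive_process = prob_space M
  for M :: "'w measure" and X :: "real \<Rightarrow> 'w \<Rightarrow> 'a::euclidean_space" +
  assumes random_variable: "0 \<le> t \<Longrightarrow> random_variable borel (X t)"
    and start: "AE \<omega> in M. X 0 \<omega> = 0"
    and stochastically_continuous:
      "\<lbrakk>0 \<le> t; 0 < \<epsilon>\<rbrakk> \<Longrightarrow>
        ((\<lambda>s. prob {\<omega> \<in> space M. norm (X s \<omega> - X t \<omega>) > \<epsilon>}) \<longlongrightarrow> 0) (at t within {0..})"
    and indep_increments:
      "\<And>(n::nat) (\<tau>::nat \<Rightarrow> real). \<lbrakk>0 \<le> \<tau> 0; \<And>k. k < n \<Longrightarrow> \<tau> k < \<tau> (Suc k)\<rbrakk> \<Longrightarrow>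
        indep_vars (\<lambda>_. borel) (\<lambda>k \<omega>. X (\<tau> (Suc k)) \<omega> - X (\<tau> k) \<omega>) {..<n}"
    and right_continuous:
      "\<lbrakk>\<omega> \<in> space M; 0 \<le> t\<rbrakk> \<Longrightarrow> continuous (at_right t) (\<lambda>s. X s \<omega>)"
    and left_limits:
      "\<lbrakk>\<omega> \<in> space M; 0 < t\<rbrakk> \<Longrightarrow> \<exists>l. ((\<lambda>s. X s \<omega>) \<longlongrightarrow> l) (at_left t)"

locale semi_levy_process = additive_process M X
  for M :: "'w measure" and X :: "real \<Rightarrow> 'w \<Rightarrow> 'a::euclidean_space" +
  fixes p :: real
  assumes period_pos: "0 < p"
    and periodic_increments:
      "\<lbrakk>0 \<le> s; 0 \<le> t\<rbrakk> \<Longrightarrow>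
        distr M borel (\<lambda>\<omega>. X (t + p) \<omega> - X (s + p) \<omega>) = distr M borel (\<lambda>\<omega>. X t \<omega> - X s \<omega>)"

text \<open>Limits inferior are taken in the extended reals, so that they always exist.\<close>

definition recurrent_from ::
    "'w measure \<Rightarrow> (real \<Rightarrow> 'w \<Rightarrow> 'a::euclidean_space) \<Rightarrow> real \<Rightarrow> bool" where
  "recurrent_from M X s \<longleftrightarrow>
    (AE \<omega> in M. Liminf at_top (\<lambda>t. ereal (norm (X t \<omega> - X s \<omega>))) = 0)"

definition recurrent :: "'w measure \<Rightarrow> (real \<Rightarrow> 'w \<Rightarrow> 'a::euclidean_space) \<Rightarrow> bool" where
  "recurrent M X \<longleftrightarrow> (\<forall>s\<ge>0. recurrent_from M X s)"

definition transient :: "'w measure \<Rightarrow> (real \<Rightarrow> 'w \<Rightarrow> 'a::euclidean_space) \<Rightarrow> bool" where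
  "transient M X \<longleftrightarrow> (AE \<omega> in M. filterlim (\<lambda>t. norm (X t \<omega>)) at_top at_top)"

definition recurrent_seq :: "'w measure \<Rightarrow> (nat \<Rightarrow> 'w \<Rightarrow> 'a::euclidean_space) \<Rightarrow> bool" where
  "recurrent_seq M S \<longleftrightarrow>
    (\<forall>m. AE \<omega> in M. liminf (\<lambda>n. ereal (norm (S n \<omega> - S m \<omega>))) = 0)"

end

theory Submission
  imports Defs
begin

text \<open>
  Everything follows from one dichotomy, together with the remark that the restarted process
  \<open>X (s + t) - X s\<close> is semi-Levy with the same period.

  Sampled at the multiples of the period, \<open>X (n p) - X 0\<close> is a random walk with i.i.d. increments. Restarting
  the walk at its first visit to a small ball shows that the expected number of visits to a ball around \<open>0\<close>
  is finite for all radii or infinite for all radii (\<open>summable_visits\<close>). If it is infinite, a count of the times of last visit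
  shows that the walk almost surely returns infinitely often to every neighbourhood of \<open>0\<close>
  (\<open>escape_times_visits_bounded\<close>). If it is finite, an inequality of Ottaviani type controls the
  process during a whole period by its position at the end of the period (\<open>prob_period_visit_le\<close>). Then the expected
  time spent in any ball is finite, and by the Borel-Cantelli lemma the process is transient.

  So a process that is not transient returns to its starting point along the multiples of the period. Whether a process
  is transient does not depend on the time at which it is restarted, so a process that is not transient
  returns in this way to \<open>X s\<close> for every \<open>s\<close> (\<open>returns_if_not_transient\<close>), and recurrence is the negation of
  transience. Returns to \<open>X s\<close> for small \<open>s\<close>, combined with Fubini's theorem and right-continuity at
  time \<open>0\<close>, make the occupation time of every ball around \<open>0\<close> infinite
  (\<open>infinite_occupation_if_not_transient\<close>); its expectation is the integral of \<open>P (X t \<in> B)\<close> over time. Both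
  integral criteria thus separate the two cases.

  For the sequence \<open>X (n h)\<close> with \<open>h\<close> a rational multiple of \<open>p\<close>, some multiple of \<open>h\<close> is also a multiple of \<open>p\<close>. It is itself a
  period, and the returns along it are returns of the sequence.
\<close>

section \<open>Limits at infinity and from the right\<close>

lemma Liminf_norm_eq_0_iff:
  assumes "F \<noteq> bot"
  shows "Liminf F (\<lambda>x. ereal (norm (f x))) = 0 \<longleftrightarrow> (\<forall>e>0. \<exists>\<^sub>F x in F. norm (f x) < e)"
proof (intro iffI allI impI)
  fix e :: real assume L: "Liminf F (\<lambda>x. ereal (norm (f x))) = 0" and "0 < e"
  show "\<exists>\<^sub>F x in F. norm (f x) < e"
  proof (rule ccontr)
    assume "\<not> (\<exists>\<^sub>F x in F. norm (f x) < e)"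
    then have "\<forall>\<^sub>F x in F. ereal e \<le> ereal (norm (f x))"
      by (simp add: not_frequently not_less)
    then have "ereal e \<le> Liminf F (\<lambda>x. ereal (norm (f x)))" by (rule Liminf_bounded)
    with L \<open>0 < e\<close> show False by simp
  qed
next
  assume R: "\<forall>e>0. \<exists>\<^sub>F x in F. norm (f x) < e"
  have "0 \<le> Liminf F (\<lambda>x. ereal (norm (f x)))"
    by (rule Liminf_bounded) simp
  moreover have "\<not> 0 < Liminf F (\<lambda>x. ereal (norm (f x)))"
  proof
    assume "0 < Liminf F (\<lambda>x. ereal (norm (f x)))"
    then obtain e where e: "0 < ereal e" "ereal e < Liminf F (\<lambda>x. ereal (norm (f x)))"
      using ereal_dense2 by blast
    have "\<forall>\<^sub>F x in F. ereal e < ereal (norm (f x))" by (rule less_LiminfD[OF e(2)])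
    then have "\<not> (\<exists>\<^sub>F x in F. norm (f x) < e)"
      by (auto simp: not_frequently not_less elim: eventually_mono)
    with R e(1) show False by simp
  qed
  ultimately show "Liminf F (\<lambda>x. ereal (norm (f x))) = 0" by auto
qed

text \<open>
  Transience of the process restarted at time \<open>s\<close> is inherited by the process itself, so restarting a
  process that is not transient gives again one that is not transient.
\<close>

lemma norm_at_top_of_shifted:
  fixes f :: "real \<Rightarrow> 'a::real_normed_vector"
  assumes "filterlim (\<lambda>t. norm (f (s + t) - c)) at_top at_top"
  shows "filterlim (\<lambda>t. norm (f t)) at_top at_top"
proof -
  have "filterlim (\<lambda>t. f (s + t) - c) at_infinity at_top"
    using assms by (simp add: filterlim_at_infinity_conv_norm_at_top)
  then have "filterlim (\<lambda>t. c + (f (s + t) - c)) at_infinity at_top"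
    by (rule tendsto_add_filterlim_at_infinity[OF tendsto_const])
  moreover have "filterlim (\<lambda>t :: real. - s + t) at_top at_top"
    by (rule filterlim_tendsto_add_at_top[OF tendsto_const filterlim_ident])
  ultimately have "filterlim (\<lambda>t. c + (f (s + (- s + t)) - c)) at_infinity at_top"
    by (rule filterlim_compose)
  then show ?thesis by (simp add: filterlim_at_infinity_conv_norm_at_top)
qed

text \<open>
  The grid point is strictly to the right of \<open>t\<close>, even when \<open>t\<close> lies on the grid. Along shrinking meshes it
  thus approaches \<open>t\<close> within \<open>at_right t\<close>, the filter for which right-continuity is assumed, and a
  right-continuous path is a limit of its values on countably many times.
\<close>

definition next_grid_point :: "real \<Rightarrow> real \<Rightarrow> real" where
  "next_grid_point \<delta> t = (of_int \<lfloor>t / \<delta>\<rfloor> + 1) * \<delta>"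

lemma next_grid_point_bounds:
  assumes "0 < \<delta>"
  shows "t < next_grid_point \<delta> t" "next_grid_point \<delta> t \<le> t + \<delta>"
proof -
  have "t / \<delta> < of_int \<lfloor>t / \<delta>\<rfloor> + 1" by linarith
  moreover have "of_int \<lfloor>t / \<delta>\<rfloor> * \<delta> \<le> t / \<delta> * \<delta>"
    using assms by (intro mult_right_mono) auto
  ultimately show "t < next_grid_point \<delta> t" "next_grid_point \<delta> t \<le> t + \<delta>"
    using assms by (simp_all add: next_grid_point_def field_simps)
qed

lemma next_grid_point_tendsto:
  assumes "0 < p"
  shows "filterlim (\<lambda>m. next_grid_point (p / 2 ^ m) t) (at_right t) sequentially"
proof -
  have "(\<lambda>m. p * (1 / 2) ^ m) \<longlonglongrightarrow> p * 0"
    by (intro tendsto_mult tendsto_const LIMSEQ_power_zero) simp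
  then have "(\<lambda>m. p / 2 ^ m) \<longlonglongrightarrow> 0" by (simp add: power_divide)
  then have "(\<lambda>m. t + p / 2 ^ m) \<longlonglongrightarrow> t + 0" by (intro tendsto_add tendsto_const)
  then have upper: "(\<lambda>m. t + p / 2 ^ m) \<longlonglongrightarrow> t" by simp
  have b: "t < next_grid_point (p / 2 ^ m) t" "next_grid_point (p / 2 ^ m) t \<le> t + p / 2 ^ m" for m
    using next_grid_point_bounds[of "p / 2 ^ m" t] assms by auto
  have "(\<lambda>m. next_grid_point (p / 2 ^ m) t) \<longlonglongrightarrow> t"
    by (rule tendsto_sandwich[OF _ _ tendsto_const upper]) (use b in \<open>simp_all add: less_imp_le\<close>)
  then show ?thesis
    using b(1) by (simp add: filterlim_at less_imp_neq[symmetric])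
qed

lemma suminf_indicator_infinitely_often:
  assumes "\<exists>\<^sub>F n in sequentially. x n \<in> A"
  shows "(\<Sum>n. indicator A (x n) :: ennreal) = \<infinity>"
proof (rule ccontr)
  assume "\<not> ?thesis"
  then have "(\<Sum>n. ennreal (indicator A (x n))) \<noteq> top" by (simp add: ennreal_indicator)
  then have "summable (\<lambda>n. indicator A (x n) :: real)" by (intro summable_suminf_not_top) auto
  then have "(\<lambda>n. indicator A (x n) :: real) \<longlonglongrightarrow> 0" by (rule summable_LIMSEQ_zero)
  from order_tendstoD(2)[OF this, of 1] have "\<forall>\<^sub>F n in sequentially. x n \<notin> A"
    by (auto elim!: eventually_mono simp: indicator_def split: if_splits)
  with assms show False by (simp add: frequently_def)
qed

lemma arithmetic_progression_at_top:
  fixes p :: real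
  assumes "0 < p"
  shows "filterlim (\<lambda>n. s + real n * p) at_top sequentially"
  using assms by (intro filterlim_tendsto_add_at_top[OF tendsto_const]
      filterlim_at_top_mult_tendsto_pos[OF tendsto_const _ filterlim_real_sequentially])

text \<open>
  Returns are produced along arithmetic progressions of times; this is what turns them into returns
  in continuous time, or along the multiples of a finer step.
\<close>

lemma frequently_along:
  assumes "\<exists>\<^sub>F n in F. P (g n)" and "filterlim g G F"
  shows "\<exists>\<^sub>F x in G. P x"
  using assms unfolding frequently_def filterlim_iff by blast

section \<open>Sequences with independent increments\<close>

text \<open>
  The partial sums themselves are the primitive notion, and not their summands, because the sums are what is
  sampled from a process: \<open>S n = X (n \<delta>) - X 0\<close>. Subtracting \<open>X 0\<close> makes the start exact, whereas
  \<open>X 0 = 0\<close> itself holds only almost surely.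
\<close>

locale independent_increment_walk = prob_space M
  for M :: "'w measure" and S :: "nat \<Rightarrow> 'w \<Rightarrow> 'a::euclidean_space" +
  assumes walk_start: "S 0 \<omega> = 0"
    and walk_indep: "indep_vars (\<lambda>_. borel) (\<lambda>i \<omega>. S (Suc i) \<omega> - S i \<omega>) UNIV"
begin

lemma walk_eq_sum: "S n \<omega> = (\<Sum>i<n. S (Suc i) \<omega> - S i \<omega>)"
  using sum_lessThan_telescope[of "\<lambda>i. S i \<omega>" n] by (simp add: walk_start)

lemma walk_increment_measurable: "random_variable borel (\<lambda>\<omega>. S (Suc i) \<omega> - S i \<omega>)"
  using walk_indep by (auto simp: indep_vars_def)

lemma walk_measurable [measurable]: "random_variable borel (S n)"
proof -
  have "random_variable borel (\<lambda>\<omega>. \<Sum>i<n. S (Suc i) \<omega> - S i \<omega>)"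
    using walk_increment_measurable by measurable
  then show ?thesis
    by (simp add: walk_eq_sum[symmetric])
qed

lemma walk_sequence_measurable [measurable]:
  "(\<lambda>\<omega> n. S n \<omega>) \<in> M \<rightarrow>\<^sub>M PiM UNIV (\<lambda>_. borel)"
  "(\<lambda>\<omega> n. S (k + n) \<omega> - S k \<omega>) \<in> M \<rightarrow>\<^sub>M PiM UNIV (\<lambda>_. borel)"
  by (auto intro!: measurable_PiM_single' simp: space_PiM)

text \<open>
  The past up to time \<open>k\<close> is a function of the first \<open>k\<close> increments and the future path of the remaining ones,
  and disjoint blocks of an independent family are independent. That \<open>A\<close> concerns only the past is
  expressed by invariance under changes of the path after time \<open>k\<close>.
\<close>

lemma future_independent_of_past:
  assumes A [measurable]: "Measurable.pred (PiM UNIV (\<lambda>_. borel)) A"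
    and B [measurable]: "Measurable.pred (PiM UNIV (\<lambda>_. borel)) B"
    and past: "\<And>x y. (\<And>j. j \<le> k \<Longrightarrow> x j = y j) \<Longrightarrow> A x = A y"
  shows "prob {\<omega> \<in> space M. A (\<lambda>n. S n \<omega>) \<and> B (\<lambda>n. S (k + n) \<omega> - S k \<omega>)} =
    prob {\<omega> \<in> space M. A (\<lambda>n. S n \<omega>)} * prob {\<omega> \<in> space M. B (\<lambda>n. S (k + n) \<omega> - S k \<omega>)}"
proof -
  define D where "D = (\<lambda>i \<omega>. S (Suc i) \<omega> - S i \<omega>)"
  \<comment> \<open>\<open>f\<close> freezes the walk at time \<open>k\<close>, so that \<open>A\<close> can be evaluated from the first \<open>k\<close> increments alone.\<close>
  define f where "f = (\<lambda>(x :: nat \<Rightarrow> 'a) n. \<Sum>i<min n k. x i)"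
  define g where "g = (\<lambda>(x :: nat \<Rightarrow> 'a) n. \<Sum>i\<in>{k..<k + n}. x i)"
  have [measurable]: "f \<in> PiM {..<k} (\<lambda>_. borel) \<rightarrow>\<^sub>M PiM UNIV (\<lambda>_. borel)"
    unfolding f_def by (rule measurable_PiM_single') (auto simp: space_PiM intro!: borel_measurable_sum measurable_component_singleton)
  have [measurable]: "g \<in> PiM {k..} (\<lambda>_. borel) \<rightarrow>\<^sub>M PiM UNIV (\<lambda>_. borel)"
    unfolding g_def by (rule measurable_PiM_single') (auto simp: space_PiM intro!: borel_measurable_sum measurable_component_singleton)
  have "indep_var (PiM {..<k} (\<lambda>_. borel)) (\<lambda>\<omega>. restrict (\<lambda>i. D i \<omega>) {..<k})
      (PiM {k..} (\<lambda>_. borel)) (\<lambda>\<omega>. restrict (\<lambda>i. D i \<omega>) {k..})"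
    using walk_indep unfolding D_def by (rule indep_var_restrict) auto
  then have "indep_var (count_space UNIV) ((A \<circ> f) \<circ> (\<lambda>\<omega>. restrict (\<lambda>i. D i \<omega>) {..<k}))
      (count_space UNIV) ((B \<circ> g) \<circ> (\<lambda>\<omega>. restrict (\<lambda>i. D i \<omega>) {k..}))"
    by (rule indep_var_compose) (auto intro!: measurable_comp)
  from indep_varD[OF this, of "{True}" "{True}"]
  have *: "prob {\<omega> \<in> space M. A (f (restrict (\<lambda>i. D i \<omega>) {..<k})) \<and> B (g (restrict (\<lambda>i. D i \<omega>) {k..}))} =
    prob {\<omega> \<in> space M. A (f (restrict (\<lambda>i. D i \<omega>) {..<k}))} *
    prob {\<omega> \<in> space M. B (g (restrict (\<lambda>i. D i \<omega>) {k..}))}"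
    by (simp add: vimage_def Int_def conj_commute)
  have "A (f (restrict (\<lambda>i. D i \<omega>) {..<k})) = A (\<lambda>n. S n \<omega>)" for \<omega>
    by (rule past) (simp add: f_def D_def min_absorb1 walk_eq_sum[symmetric])
  moreover have "g (restrict (\<lambda>i. D i \<omega>) {k..}) = (\<lambda>n. S (k + n) \<omega> - S k \<omega>)" for \<omega>
  proof
    fix n
    show "g (restrict (\<lambda>i. D i \<omega>) {k..}) n = S (k + n) \<omega> - S k \<omega>"
      using sum_Suc_diff'[of k "k + n" "\<lambda>i. S i \<omega>"] by (simp add: g_def D_def)
  qed
  ultimately show ?thesis using * by simp
qed

end

locale random_walk = independent_increment_walk M S
  for M :: "'w measure" and S :: "nat \<Rightarrow> 'w \<Rightarrow> 'a::euclidean_space" +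
  assumes walk_identical:
    "distr M borel (\<lambda>\<omega>. S (Suc i) \<omega> - S i \<omega>) = distr M borel (\<lambda>\<omega>. S 1 \<omega> - S 0 \<omega>)"
begin

text \<open>
  Both sides are probabilities of one and the same event for an i.i.d. sequence: the law of the increments
  from time \<open>k\<close> on is a product of copies of a single law, whatever \<open>k\<close> is.
\<close>

lemma future_distributed_as_walk:
  assumes B [measurable]: "Measurable.pred (PiM UNIV (\<lambda>_. borel)) B"
  shows "prob {\<omega> \<in> space M. B (\<lambda>n. S (k + n) \<omega> - S k \<omega>)} = prob {\<omega> \<in> space M. B (\<lambda>n. S n \<omega>)}"
proof -
  define D where "D = (\<lambda>i \<omega>. S (Suc i) \<omega> - S i \<omega>)"
  have D_meas: "random_variable borel (D i)" for i
    using walk_increment_measurable by (simp add: D_def)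
  define g where "g = (\<lambda>(x :: nat \<Rightarrow> 'a) n. \<Sum>i<n. x i)"
  have g [measurable]: "g \<in> PiM UNIV (\<lambda>_. borel) \<rightarrow>\<^sub>M PiM UNIV (\<lambda>_. borel)"
    unfolding g_def by (rule measurable_PiM_single') (auto simp: space_PiM intro!: borel_measurable_sum measurable_component_singleton)
  have law: "distr M (PiM UNIV (\<lambda>_. borel)) (\<lambda>\<omega> i. D (k + i) \<omega>) = PiM UNIV (\<lambda>_. distr M borel (D 0))" for k
  proof -
    have "indep_vars (\<lambda>_. borel) (\<lambda>i. D (k + i)) UNIV"
      unfolding indep_vars_def2
    proof (intro conjI ballI)
      show "indep_sets (\<lambda>i. {D (k + i) -` A \<inter> space M |A. A \<in> sets borel}) UNIV"
      proof (rule indep_setsI)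
        fix i show "{D (k + i) -` A \<inter> space M |A. A \<in> sets borel} \<subseteq> events"
          using D_meas by (auto intro: measurable_sets)
      next
        fix A and J :: "nat set"
        assume J: "J \<noteq> {}" "finite J" "J \<subseteq> UNIV"
          and A: "\<forall>j\<in>J. A j \<in> {D (k + j) -` A \<inter> space M |A. A \<in> sets borel}"
        have "indep_sets (\<lambda>i. {D i -` A \<inter> space M |A. A \<in> sets borel}) UNIV"
          using walk_indep by (simp add: indep_vars_def2 D_def)
        then have "prob (\<Inter>j\<in>(+) k ` J. A (j - k)) = (\<Prod>j\<in>(+) k ` J. prob (A (j - k)))"
          by (rule indep_setsD) (use J A in auto)
        then show "prob (\<Inter>j\<in>J. A j) = (\<Prod>j\<in>J. prob (A j))"
          by (simp add: prod.reindex)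
      qed
    qed (use D_meas in auto)
    then have "distr M (PiM UNIV (\<lambda>_. borel)) (\<lambda>\<omega>. \<lambda>i\<in>UNIV. D (k + i) \<omega>) =
        PiM UNIV (\<lambda>i. distr M borel (D (k + i)))"
      by (subst (asm) indep_vars_iff_distr_eq_PiM) (use D_meas in auto)
    moreover have "distr M borel (D (k + i)) = distr M borel (D 0)" for i
      unfolding D_def using walk_identical[of "k + i"] by (simp only: One_nat_def)
    ultimately show ?thesis by (simp only: restrict_UNIV)
  qed
  have [measurable]: "(\<lambda>\<omega> i. D (k + i) \<omega>) \<in> M \<rightarrow>\<^sub>M PiM UNIV (\<lambda>_. borel)" for k
    using D_meas by (auto intro!: measurable_PiM_single' simp: space_PiM)
  have "{x \<in> space (PiM UNIV (\<lambda>_. borel)). B (g x)} \<in> sets (PiM UNIV (\<lambda>_. borel))"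
    by measurable
  then have "prob {\<omega> \<in> space M. B (g (\<lambda>i. D (k + i) \<omega>))} =
      measure (PiM UNIV (\<lambda>_. distr M borel (D 0))) {x \<in> space (PiM UNIV (\<lambda>_. borel)). B (g x)}" for k
    unfolding law[of k, symmetric]
    by (subst measure_distr) (auto simp: space_PiM Int_def vimage_def intro!: arg_cong[where f = prob])
  from this[of k] this[of 0]
  have "prob {\<omega> \<in> space M. B (g (\<lambda>i. D (k + i) \<omega>))} = prob {\<omega> \<in> space M. B (g (\<lambda>i. D (0 + i) \<omega>))}"
    by simp
  moreover have "g (\<lambda>i. D (k + i) \<omega>) = (\<lambda>n. S (k + n) \<omega> - S k \<omega>)" for \<omega> k
  proof
    fix n
    show "g (\<lambda>i. D (k + i) \<omega>) n = S (k + n) \<omega> - S k \<omega>"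
      using sum_lessThan_telescope[of "\<lambda>i. S (k + i) \<omega>" n] by (simp add: g_def D_def)
  qed
  ultimately have "prob {\<omega> \<in> space M. B (\<lambda>n. S (k + n) \<omega> - S k \<omega>)} =
      prob {\<omega> \<in> space M. B (\<lambda>n. S (0 + n) \<omega> - S 0 \<omega>)}"
    by (simp only:)
  then show ?thesis by (simp add: walk_start)
qed

text \<open>
  The Markov property of a random walk at a fixed time.
\<close>

lemma restart:
  assumes A: "Measurable.pred (PiM UNIV (\<lambda>_. borel)) A"
    and B: "Measurable.pred (PiM UNIV (\<lambda>_. borel)) B"
    and past: "\<And>x y. (\<And>j. j \<le> k \<Longrightarrow> x j = y j) \<Longrightarrow> A x = A y"
  shows "prob {\<omega> \<in> space M. A (\<lambda>n. S n \<omega>) \<and> B (\<lambda>n. S (k + n) \<omega> - S k \<omega>)} =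
    prob {\<omega> \<in> space M. A (\<lambda>n. S n \<omega>)} * prob {\<omega> \<in> space M. B (\<lambda>n. S n \<omega>)}"
  using future_independent_of_past[OF A B past] future_distributed_as_walk[OF B] by simp

end

section \<open>First entrances and Ottaviani's inequality\<close>

text \<open>
  The target may depend on time, so that entrances can be restricted to a set of times by taking the target
  empty at the others.
\<close>

definition first_entrance :: "(nat \<Rightarrow> 'a set) \<Rightarrow> nat \<Rightarrow> (nat \<Rightarrow> 'a) \<Rightarrow> bool" where
  "first_entrance C k x \<longleftrightarrow> x k \<in> C k \<and> (\<forall>j<k. x j \<notin> C j)"

lemma first_entrance_measurable:
  fixes C :: "nat \<Rightarrow> 'a::topological_space set"
  assumes "\<And>k. C k \<in> sets borel"
  shows "Measurable.pred (PiM UNIV (\<lambda>_. borel)) (first_entrance C k)"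
proof -
  have [measurable]: "C k \<in> sets borel" for k by fact
  show ?thesis unfolding first_entrance_def by measurable
qed

lemma ex_first_entrance:
  "(\<exists>k\<le>n. x k \<in> C k) \<longleftrightarrow> (\<exists>k\<le>n. first_entrance C k x)"
proof
  assume "\<exists>k\<le>n. x k \<in> C k"
  then obtain k where k: "k \<le> n" "x k \<in> C k" by auto
  define l where "l = (LEAST k. x k \<in> C k)"
  have "x l \<in> C l" "l \<le> k" "\<forall>j<l. x j \<notin> C j"
    using k unfolding l_def by (auto intro: LeastI Least_le dest: not_less_Least)
  then show "\<exists>k\<le>n. first_entrance C k x"
    using k by (auto simp: first_entrance_def intro!: exI[of _ l])
qed (auto simp: first_entrance_def)

lemma first_entrance_unique: "first_entrance C k x \<Longrightarrow> first_entrance C l x \<Longrightarrow> k = l"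
  by (cases k l rule: linorder_cases) (auto simp: first_entrance_def)

context independent_increment_walk
begin

lemma prob_first_entrance_decomposition:
  assumes C: "\<And>k. C k \<in> sets borel" and Q [measurable]: "Measurable.pred M Q"
  shows "prob {\<omega> \<in> space M. (\<exists>k\<le>n. S k \<omega> \<in> C k) \<and> Q \<omega>} =
    (\<Sum>k\<le>n. prob {\<omega> \<in> space M. first_entrance C k (\<lambda>n. S n \<omega>) \<and> Q \<omega>})"
proof -
  note [measurable] = first_entrance_measurable[OF C]
  let ?F = "\<lambda>k. {\<omega> \<in> space M. first_entrance C k (\<lambda>n. S n \<omega>) \<and> Q \<omega>}"
  have "(\<Sum>k\<le>n. prob (?F k)) = prob (\<Union>k\<le>n. ?F k)"
    by (rule finite_measure_finite_Union[symmetric])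
       (auto simp: disjoint_family_on_def dest: first_entrance_unique)
  also have "(\<Union>k\<le>n. ?F k) = {\<omega> \<in> space M. (\<exists>k\<le>n. S k \<omega> \<in> C k) \<and> Q \<omega>}"
  proof (intro set_eqI)
    fix \<omega>
    show "\<omega> \<in> (\<Union>k\<le>n. ?F k) \<longleftrightarrow> \<omega> \<in> {\<omega> \<in> space M. (\<exists>k\<le>n. S k \<omega> \<in> C k) \<and> Q \<omega>}"
      using ex_first_entrance[of n "\<lambda>n. S n \<omega>" C] by auto
  qed
  finally show ?thesis by simp
qed

lemma prob_entrance:
  assumes C: "\<And>k. C k \<in> sets borel"
  shows "prob {\<omega> \<in> space M. \<exists>k\<le>n. S k \<omega> \<in> C k} =
    (\<Sum>k\<le>n. prob {\<omega> \<in> space M. first_entrance C k (\<lambda>n. S n \<omega>)})"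
  using prob_first_entrance_decomposition[OF C, where Q = "\<lambda>_. True" and n = n] by simp

text \<open>
  At the first time \<open>k\<close> in \<open>J\<close> at which the walk is in the ball of radius \<open>a\<close>, the remaining increment is independent of the past
  and has norm below \<open>R\<close> with probability at least one half; when that happens, the walk ends within \<open>a + R\<close>. So an
  approach at any time of \<open>J\<close> costs at most a factor two compared with an approach at the final time.
\<close>

lemma ottaviani_inequality:
  assumes J: "J \<subseteq> {..N}"
    and R: "\<And>k. k \<in> J \<Longrightarrow> 1 / 2 \<le> prob {\<omega> \<in> space M. norm (S N \<omega> - S k \<omega>) < R}"
  shows "prob {\<omega> \<in> space M. \<exists>k\<in>J. norm (S k \<omega>) < a} \<le> 2 * prob {\<omega> \<in> space M. norm (S N \<omega>) < a + R}"
proof -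
  define C where "C = (\<lambda>k. if k \<in> J then ball (0 :: 'a) a else {})"
  have C: "C k \<in> sets borel" for k by (simp add: C_def)
  note [measurable] = first_entrance_measurable[OF C]
  let ?F = "\<lambda>k. {\<omega> \<in> space M. first_entrance C k (\<lambda>n. S n \<omega>)}"
  let ?G = "\<lambda>k. {\<omega> \<in> space M. first_entrance C k (\<lambda>n. S n \<omega>) \<and> norm (S N \<omega>) < a + R}"
  have step: "prob (?F k) \<le> 2 * prob (?G k)" if "k \<le> N" for k
  proof (cases "k \<in> J")
    case True
    have "prob {\<omega> \<in> space M. first_entrance C k (\<lambda>n. S n \<omega>) \<and> norm (S (k + (N - k)) \<omega> - S k \<omega>) < R} =
        prob (?F k) * prob {\<omega> \<in> space M. norm (S (k + (N - k)) \<omega> - S k \<omega>) < R}"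
      by (rule future_independent_of_past[where A = "first_entrance C k" and B = "\<lambda>x. norm (x (N - k)) < R",
            OF first_entrance_measurable[OF C]])
         (measurable, simp add: first_entrance_def)
    also have "\<dots> \<ge> prob (?F k) * (1 / 2)"
      using R[OF True] that by (intro mult_left_mono) auto
    finally have "prob (?F k) \<le> 2 * prob {\<omega> \<in> space M. first_entrance C k (\<lambda>n. S n \<omega>) \<and> norm (S N \<omega> - S k \<omega>) < R}"
      using that by simp
    also have "\<dots> \<le> 2 * prob (?G k)"
    proof (intro mult_left_mono finite_measure_mono)
      show "{\<omega> \<in> space M. first_entrance C k (\<lambda>n. S n \<omega>) \<and> norm (S N \<omega> - S k \<omega>) < R} \<subseteq> ?G k"
      proof clarify
        fix \<omega> assume "first_entrance C k (\<lambda>n. S n \<omega>)" "norm (S N \<omega> - S k \<omega>) < R"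
        then show "norm (S N \<omega>) < a + R"
          using True norm_triangle_sub[of "S N \<omega>" "S k \<omega>"] by (simp add: first_entrance_def C_def)
      qed
    qed auto
    finally show ?thesis .
  qed (simp add: first_entrance_def C_def)
  have "prob {\<omega> \<in> space M. \<exists>k\<in>J. norm (S k \<omega>) < a} = prob {\<omega> \<in> space M. \<exists>k\<le>N. S k \<omega> \<in> C k}"
    using J by (auto simp: C_def split: if_splits intro!: arg_cong[where f = prob])
  also have "\<dots> = (\<Sum>k\<le>N. prob (?F k))"
    by (rule prob_entrance[OF C])
  also have "\<dots> \<le> (\<Sum>k\<le>N. 2 * prob (?G k))"
    by (intro sum_mono step) auto
  also have "\<dots> = 2 * prob {\<omega> \<in> space M. (\<exists>k\<le>N. S k \<omega> \<in> C k) \<and> norm (S N \<omega>) < a + R}"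
    unfolding sum_distrib_left[symmetric]
    by (rule arg_cong[where f = "(*) 2"], rule prob_first_entrance_decomposition[OF C, symmetric]) measurable
  also have "\<dots> \<le> 2 * prob {\<omega> \<in> space M. norm (S N \<omega>) < a + R}"
    by (intro mult_left_mono finite_measure_mono) auto
  finally show ?thesis .
qed

end

section \<open>Random walks: visits and returns\<close>

context random_walk
begin

text \<open>
  Two points of a ball of radius \<open>a / 2\<close> are less than \<open>a\<close> apart. Hence each visit to such a ball is, seen
  from the first visit, a visit of the restarted walk to the ball of radius \<open>a\<close> around \<open>0\<close>.
\<close>

lemma visits_of_ball_le_visits_of_centred_ball:
  "(\<Sum>n<N. prob {\<omega> \<in> space M. S n \<omega> \<in> ball x (a / 2)}) \<le> (\<Sum>n<N. prob {\<omega> \<in> space M. norm (S n \<omega>) < a})"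
proof -
  define C :: "nat \<Rightarrow> 'a set" where "C = (\<lambda>_. ball x (a / 2))"
  have C: "C k \<in> sets borel" for k by (simp add: C_def)
  note [measurable] = first_entrance_measurable[OF C]
  define c where "c k = prob {\<omega> \<in> space M. first_entrance C k (\<lambda>n. S n \<omega>)}" for k
  define d where "d n = prob {\<omega> \<in> space M. norm (S n \<omega>) < a}" for n
  have nonneg: "0 \<le> c k" "0 \<le> d k" for k
    by (simp_all add: c_def d_def)
  have conv: "prob {\<omega> \<in> space M. S n \<omega> \<in> ball x (a / 2)} \<le> (\<Sum>k\<le>n. c k * d (n - k))" for n
  proof -
    have "prob {\<omega> \<in> space M. S n \<omega> \<in> ball x (a / 2)} =
        prob {\<omega> \<in> space M. (\<exists>k\<le>n. S k \<omega> \<in> C k) \<and> S n \<omega> \<in> ball x (a / 2)}"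
      by (auto simp: C_def intro!: arg_cong[where f = prob])
    also have "\<dots> = (\<Sum>k\<le>n. prob {\<omega> \<in> space M. first_entrance C k (\<lambda>n. S n \<omega>) \<and> S n \<omega> \<in> ball x (a / 2)})"
      by (rule prob_first_entrance_decomposition[OF C]) (unfold mem_ball, measurable)
    also have "\<dots> \<le> (\<Sum>k\<le>n. c k * d (n - k))"
    proof (intro sum_mono)
      fix k assume "k \<in> {..n}"
      then have k: "k + (n - k) = n" by simp
      have "prob {\<omega> \<in> space M. first_entrance C k (\<lambda>n. S n \<omega>) \<and> S n \<omega> \<in> ball x (a / 2)} \<le>
          prob {\<omega> \<in> space M. first_entrance C k (\<lambda>n. S n \<omega>) \<and> norm (S (k + (n - k)) \<omega> - S k \<omega>) < a}"
        unfolding k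
      proof (intro finite_measure_mono subsetI)
        fix \<omega> assume "\<omega> \<in> {\<omega> \<in> space M. first_entrance C k (\<lambda>n. S n \<omega>) \<and> S n \<omega> \<in> ball x (a / 2)}"
        then show "\<omega> \<in> {\<omega> \<in> space M. first_entrance C k (\<lambda>n. S n \<omega>) \<and> norm (S n \<omega> - S k \<omega>) < a}"
          using dist_triangle_half_r[of x "S n \<omega>" a "S k \<omega>"] by (simp add: first_entrance_def C_def dist_norm)
      qed measurable
      also have "\<dots> = c k * d (n - k)"
        unfolding c_def d_def
        by (rule restart[where A = "first_entrance C k" and B = "\<lambda>x. norm (x (n - k)) < a",
              OF first_entrance_measurable[OF C]])
           (measurable, simp add: first_entrance_def)
      finally show "prob {\<omega> \<in> space M. first_entrance C k (\<lambda>n. S n \<omega>) \<and> S n \<omega> \<in> ball x (a / 2)} \<le> c k * d (n - k)" .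
    qed
    finally show ?thesis .
  qed
  have "(\<Sum>k\<le>N. c k) = prob {\<omega> \<in> space M. \<exists>k\<le>N. S k \<omega> \<in> C k}"
    unfolding c_def by (rule prob_entrance[OF C, symmetric])
  then have "(\<Sum>k\<le>N. c k) \<le> 1" by simp
  moreover have "(\<Sum>k<N. c k) \<le> (\<Sum>k\<le>N. c k)"
    using nonneg by (intro sum_mono2) auto
  ultimately have total: "(\<Sum>k<N. c k) \<le> 1" by simp
  have "(\<Sum>n<N. prob {\<omega> \<in> space M. S n \<omega> \<in> ball x (a / 2)}) \<le> (\<Sum>n<N. \<Sum>k\<le>n. c k * d (n - k))"
    by (intro sum_mono conv)
  also have "\<dots> = (\<Sum>(k, j)\<in>{(k, j). k + j < N}. c k * d j)"
    by (rule sum.triangle_reindex[symmetric])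
  also have "\<dots> \<le> (\<Sum>(k, j)\<in>{..<N} \<times> {..<N}. c k * d j)"
    using nonneg by (intro sum_mono2) auto
  also have "\<dots> = (\<Sum>k<N. c k) * (\<Sum>j<N. d j)"
    by (simp add: sum_product sum.cartesian_product)
  also have "\<dots> \<le> 1 * (\<Sum>j<N. d j)"
    using total nonneg by (intro mult_right_mono sum_nonneg) auto
  finally show ?thesis by (simp add: d_def)
qed

text \<open>
  A large ball is covered by finitely many balls of radius \<open>a / 2\<close>, so finiteness of the expected number of
  visits does not depend on the radius.
\<close>

lemma summable_visits:
  assumes a: "0 < a" and sum: "summable (\<lambda>n. prob {\<omega> \<in> space M. norm (S n \<omega>) < a})"
  shows "summable (\<lambda>n. prob {\<omega> \<in> space M. norm (S n \<omega>) < b})"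
proof -
  have "\<exists>F. F \<subseteq> cball (0 :: 'a) b \<and> finite F \<and> cball 0 b \<subseteq> (\<Union>x\<in>F. ball x (a / 2))"
    using compactE_image[of "cball (0 :: 'a) b" "cball 0 b" "\<lambda>x. ball x (a / 2)"] a by (force simp: compact_cball)
  then obtain F where F: "finite F" "cball (0 :: 'a) b \<subseteq> (\<Union>x\<in>F. ball x (a / 2))" by auto
  have ball: "summable (\<lambda>n. prob {\<omega> \<in> space M. S n \<omega> \<in> ball x (a / 2)})" for x
  proof (rule summableI_nonneg_bounded)
    fix N
    have "(\<Sum>n<N. prob {\<omega> \<in> space M. S n \<omega> \<in> ball x (a / 2)}) \<le> (\<Sum>n<N. prob {\<omega> \<in> space M. norm (S n \<omega>) < a})"
      by (rule visits_of_ball_le_visits_of_centred_ball)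
    also have "\<dots> \<le> (\<Sum>n. prob {\<omega> \<in> space M. norm (S n \<omega>) < a})"
      by (intro sum_le_suminf sum) auto
    finally show "(\<Sum>n<N. prob {\<omega> \<in> space M. S n \<omega> \<in> ball x (a / 2)}) \<le> (\<Sum>n. prob {\<omega> \<in> space M. norm (S n \<omega>) < a})" .
  qed simp
  have "prob {\<omega> \<in> space M. norm (S n \<omega>) < b} \<le> (\<Sum>x\<in>F. prob {\<omega> \<in> space M. S n \<omega> \<in> ball x (a / 2)})" for n
  proof -
    have "prob {\<omega> \<in> space M. norm (S n \<omega>) < b} \<le> prob (\<Union>x\<in>F. {\<omega> \<in> space M. S n \<omega> \<in> ball x (a / 2)})"
    proof (intro finite_measure_mono subsetI)
      fix \<omega> assume \<omega>: "\<omega> \<in> {\<omega> \<in> space M. norm (S n \<omega>) < b}"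
      then have "S n \<omega> \<in> cball 0 b" by simp
      then show "\<omega> \<in> (\<Union>x\<in>F. {\<omega> \<in> space M. S n \<omega> \<in> ball x (a / 2)})"
        using F \<omega> by blast
    qed (use F(1) in \<open>auto simp: mem_ball\<close>)
    also have "\<dots> \<le> (\<Sum>x\<in>F. prob {\<omega> \<in> space M. S n \<omega> \<in> ball x (a / 2)})"
      using F by (intro finite_measure_subadditive_finite) auto
    finally show ?thesis .
  qed
  then show ?thesis
    by (intro summable_comparison_test'[OF summable_sum[OF ball], where N = 0]) auto
qed

text \<open>
  Call \<open>k\<close> an escape time if the walk is within \<open>a\<close> at time \<open>k\<close> but no longer from time \<open>k + m\<close> on. On
  each path all escape times lie within \<open>m\<close> steps of the first one, so there are at most \<open>m\<close> of them.
  By restarting at \<open>k\<close>, the probability that \<open>k\<close> is an escape time is at least that of a visit at time \<open>k\<close>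
  times that of staying away by \<open>2 a\<close> from time \<open>m\<close> on.
\<close>

lemma escape_times_visits_bounded:
  "(\<Sum>k<N. prob {\<omega> \<in> space M. norm (S k \<omega>) < a}) *
    prob {\<omega> \<in> space M. \<forall>n\<ge>m. 2 * a \<le> norm (S n \<omega>)} \<le> real m"
proof -
  define L where "L k = {\<omega> \<in> space M. norm (S k \<omega>) < a \<and> (\<forall>n\<ge>k + m. a \<le> norm (S n \<omega>))}" for k
  have L [measurable]: "L k \<in> events" for k unfolding L_def by measurable
  have "prob {\<omega> \<in> space M. norm (S k \<omega>) < a} * prob {\<omega> \<in> space M. \<forall>n\<ge>m. 2 * a \<le> norm (S n \<omega>)} \<le> prob (L k)" for k
  proof -
    have "prob {\<omega> \<in> space M. norm (S k \<omega>) < a} * prob {\<omega> \<in> space M. \<forall>n\<ge>m. 2 * a \<le> norm (S n \<omega>)} =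
        prob {\<omega> \<in> space M. norm (S k \<omega>) < a \<and> (\<forall>n\<ge>m. 2 * a \<le> norm (S (k + n) \<omega> - S k \<omega>))}"
      by (rule restart[symmetric, where A = "\<lambda>x. norm (x k) < a" and B = "\<lambda>x. \<forall>n\<ge>m. 2 * a \<le> norm (x n)"])
         (measurable, auto)
    also have "\<dots> \<le> prob (L k)"
    proof (intro finite_measure_mono L subsetI)
      fix \<omega> assume \<omega>: "\<omega> \<in> {\<omega> \<in> space M. norm (S k \<omega>) < a \<and> (\<forall>n\<ge>m. 2 * a \<le> norm (S (k + n) \<omega> - S k \<omega>))}"
      have "a \<le> norm (S n \<omega>)" if "n \<ge> k + m" for n
      proof -
        have "m \<le> n - k" "k + (n - k) = n" using that by auto
        then have "2 * a \<le> norm (S n \<omega> - S k \<omega>)" using \<omega> by force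
        then show ?thesis using \<omega> norm_triangle_ineq4[of "S n \<omega>" "S k \<omega>"] by simp
      qed
      then show "\<omega> \<in> L k" using \<omega> by (simp add: L_def)
    qed
    finally show ?thesis .
  qed
  then have "(\<Sum>k<N. prob {\<omega> \<in> space M. norm (S k \<omega>) < a}) *
      prob {\<omega> \<in> space M. \<forall>n\<ge>m. 2 * a \<le> norm (S n \<omega>)} \<le> (\<Sum>k<N. prob (L k))"
    unfolding sum_distrib_right by (intro sum_mono)
  also have "\<dots> = (\<integral>\<omega>. (\<Sum>k<N. indicator (L k) \<omega>) \<partial>M)"
    by (subst Bochner_Integration.integral_sum) (auto simp: emeasure_eq_measure)
  also have "\<dots> \<le> (\<integral>\<omega>. real m \<partial>M)"
  proof (rule integral_mono)
    fix \<omega> assume "\<omega> \<in> space M"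
    define V where "V = {k. k < N \<and> \<omega> \<in> L k}"
    have "finite V" by (simp add: V_def)
    have "card V \<le> m"
    proof (cases "V = {}")
      case False
      define k0 where "k0 = Min V"
      have k0: "k0 \<in> V" "\<And>k. k \<in> V \<Longrightarrow> k0 \<le> k"
        using False \<open>finite V\<close> by (auto simp: k0_def)
      have "V \<subseteq> {k0..<k0 + m}"
      proof
        fix k assume k: "k \<in> V"
        then have "norm (S k \<omega>) < a" by (simp add: V_def L_def)
        moreover have "k0 + m \<le> k \<Longrightarrow> a \<le> norm (S k \<omega>)"
          using k0(1) by (simp add: V_def L_def)
        ultimately show "k \<in> {k0..<k0 + m}" using k0(2)[OF k] by force
      qed
      then show ?thesis using card_mono[of "{k0..<k0 + m}" V] by simp
    qed simp
    moreover have "(\<Sum>k<N. indicator (L k) \<omega>) = real (card V)"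
      by (simp add: indicator_def sum.If_cases V_def Int_def)
    ultimately show "(\<Sum>k<N. indicator (L k) \<omega>) \<le> real m" by simp
  qed (auto simp: emeasure_eq_measure)
  finally show ?thesis by (simp add: prob_space)
qed

text \<open>
  If the expected number of visits is infinite, the bound on escape times forces the probability of eventually
  staying away from \<open>0\<close> to vanish.
\<close>

lemma AE_infinitely_often_near_0:
  assumes "\<And>a. 0 < a \<Longrightarrow> \<not> summable (\<lambda>n. prob {\<omega> \<in> space M. norm (S n \<omega>) < a})"
  shows "AE \<omega> in M. \<forall>e>0. \<exists>\<^sub>F n in sequentially. norm (S n \<omega>) < e"
proof -
  have zero: "prob {\<omega> \<in> space M. \<forall>n\<ge>m. 2 * a \<le> norm (S n \<omega>)} = 0" (is "?g = 0") if "0 < a" for a m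
  proof (rule ccontr)
    assume "?g \<noteq> 0"
    then have g: "?g > 0" using measure_nonneg[of M] by (simp add: less_le)
    have "summable (\<lambda>n. prob {\<omega> \<in> space M. norm (S n \<omega>) < a})"
    proof (rule summableI_nonneg_bounded)
      show "(\<Sum>k<N. prob {\<omega> \<in> space M. norm (S k \<omega>) < a}) \<le> m / ?g" for N
        using escape_times_visits_bounded[where N = N and a = a and m = m] g by (simp add: field_simps)
    qed simp
    then show False using assms[OF \<open>0 < a\<close>] by simp
  qed
  have "AE \<omega> in M. \<exists>n\<ge>m. norm (S n \<omega>) < 2 / Suc j" for m j
  proof (rule AE_I')
    show "{\<omega> \<in> space M. \<forall>n\<ge>m. 2 * (1 / Suc j) \<le> norm (S n \<omega>)} \<in> null_sets M"
      using zero[of "1 / Suc j" m] by (intro null_setsI) (simp_all add: emeasure_eq_measure)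
  qed (auto simp: not_less)
  then have "AE \<omega> in M. \<forall>j m. \<exists>n\<ge>m. norm (S n \<omega>) < 2 / Suc j"
    by (simp add: AE_all_countable)
  then show ?thesis
  proof eventually_elim
    case (elim \<omega>)
    show ?case
    proof (intro allI impI)
      fix e :: real assume "0 < e"
      then obtain j where "inverse (real (Suc j)) < e / 2" using reals_Archimedean[of "e / 2"] by auto
      then have "2 / Suc j < e" by (simp add: field_simps)
      then show "\<exists>\<^sub>F n in sequentially. norm (S n \<omega>) < e"
        using elim unfolding frequently_sequentially by (meson less_trans)
    qed
  qed
qed

end

section \<open>Restarting and sampling a process\<close>

context additive_process
begin

lemma increment_measurable: "0 \<le> s \<Longrightarrow> 0 \<le> t \<Longrightarrow> random_variable borel (\<lambda>\<omega>. X t \<omega> - X s \<omega>)"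
  using random_variable by auto

lemma shifted_additive_process:
  assumes s: "0 \<le> s"
  shows "additive_process M (\<lambda>t \<omega>. X (s + t) \<omega> - X s \<omega>)"
proof
  show "random_variable borel (\<lambda>\<omega>. X (s + t) \<omega> - X s \<omega>)" if "0 \<le> t" for t
    using that s by (intro increment_measurable) auto
  show "AE \<omega> in M. X (s + 0) \<omega> - X s \<omega> = 0" by simp
  show "((\<lambda>u. prob {\<omega> \<in> space M. \<epsilon> < norm (X (s + u) \<omega> - X s \<omega> - (X (s + t) \<omega> - X s \<omega>))}) \<longlongrightarrow> 0) (at t within {0..})"
    if "0 \<le> t" "0 < \<epsilon>" for t \<epsilon>
  proof -
    have "filterlim (\<lambda>u. s + u) (at (s + t) within {0..}) (at t within {0..})"
      using s by (auto simp: filterlim_at eventually_at_filter intro!: tendsto_add[OF tendsto_const tendsto_ident_at])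
    from filterlim_compose[OF stochastically_continuous[of "s + t" \<epsilon>] this]
    show ?thesis using that s by simp
  qed
  show "indep_vars (\<lambda>_. borel) (\<lambda>k \<omega>. X (s + \<tau> (Suc k)) \<omega> - X s \<omega> - (X (s + \<tau> k) \<omega> - X s \<omega>)) {..<n}"
    if "0 \<le> \<tau> 0" "\<And>k. k < n \<Longrightarrow> \<tau> k < \<tau> (Suc k)" for n \<tau>
    using indep_increments[of "\<lambda>k. s + \<tau> k" n] that s by simp
  show "continuous (at_right t) (\<lambda>u. X (s + u) \<omega> - X s \<omega>)" if "\<omega> \<in> space M" "0 \<le> t" for \<omega> t
  proof -
    have "filterlim (\<lambda>u. s + u) (at_right (s + t)) (at_right t)"
      by (auto simp: filterlim_at eventually_at_filter intro!: tendsto_add[OF tendsto_const tendsto_ident_at])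
    moreover have "((\<lambda>u. X u \<omega>) \<longlongrightarrow> X (s + t) \<omega>) (at_right (s + t))"
      using right_continuous[of \<omega> "s + t"] that s by (simp add: continuous_within)
    ultimately have "((\<lambda>u. X (s + u) \<omega>) \<longlongrightarrow> X (s + t) \<omega>) (at_right t)"
      by (rule filterlim_compose[rotated])
    then show ?thesis unfolding continuous_within by (intro tendsto_diff tendsto_const)
  qed
  show "\<exists>l. ((\<lambda>u. X (s + u) \<omega> - X s \<omega>) \<longlongrightarrow> l) (at_left t)" if \<omega>: "\<omega> \<in> space M" and t: "0 < t" for \<omega> t
  proof -
    obtain l where l: "((\<lambda>u. X u \<omega>) \<longlongrightarrow> l) (at_left (s + t))"
      using left_limits[of \<omega> "s + t"] \<omega> add_nonneg_pos[OF s t] by blast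
    have "filterlim (\<lambda>u. s + u) (at_left (s + t)) (at_left t)"
      by (auto simp: filterlim_at eventually_at_filter intro!: tendsto_add[OF tendsto_const tendsto_ident_at])
    from tendsto_diff[OF filterlim_compose[OF l this] tendsto_const] show ?thesis by (rule exI)
  qed
qed

text \<open>
  Independence is assumed for finitely many increments only; it passes to the infinite grid because
  independence of a family is a property of its finite subfamilies.
\<close>

lemma grid_walk:
  assumes "0 < \<delta>"
  shows "independent_increment_walk M (\<lambda>n \<omega>. X (real n * \<delta>) \<omega> - X 0 \<omega>)"
proof
  have "indep_vars (\<lambda>_. borel) (\<lambda>i \<omega>. X (real (Suc i) * \<delta>) \<omega> - X (real i * \<delta>) \<omega>) UNIV"
    unfolding indep_vars_def2
  proof (intro conjI ballI)
    show "random_variable borel (\<lambda>\<omega>. X (real (Suc i) * \<delta>) \<omega> - X (real i * \<delta>) \<omega>)" for i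
      using assms by (intro increment_measurable) auto
    show "indep_sets (\<lambda>i. {(\<lambda>\<omega>. X (real (Suc i) * \<delta>) \<omega> - X (real i * \<delta>) \<omega>) -` A \<inter> space M |A. A \<in> sets borel}) UNIV"
    proof (subst indep_sets_finite_index_sets, intro allI impI)
      fix J :: "nat set" assume "finite J"
      then obtain n where n: "J \<subseteq> {..<n}" using finite_nat_iff_bounded by blast
      have "indep_vars (\<lambda>_. borel) (\<lambda>i \<omega>. X (real (Suc i) * \<delta>) \<omega> - X (real i * \<delta>) \<omega>) {..<n}"
        using indep_increments[of "\<lambda>i. real i * \<delta>" n] assms by simp
      then show "indep_sets (\<lambda>i. {(\<lambda>\<omega>. X (real (Suc i) * \<delta>) \<omega> - X (real i * \<delta>) \<omega>) -` A \<inter> space M |A. A \<in> sets borel}) J"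
        unfolding indep_vars_def2 using indep_sets_mono_index[OF n] by blast
    qed
  qed
  then show "indep_vars (\<lambda>_. borel) (\<lambda>i \<omega>. X (real (Suc i) * \<delta>) \<omega> - X 0 \<omega> - (X (real i * \<delta>) \<omega> - X 0 \<omega>)) UNIV"
    by simp
qed simp

text \<open>
  Near each \<open>t\<close> stochastic continuity gives a common bound that holds with probability at least one half, and
  finitely many such neighbourhoods cover the compact interval.
\<close>

lemma increments_tight:
  assumes T: "0 \<le> T"
  shows "\<exists>R. \<forall>t\<in>{0..T}. 1 / 2 \<le> prob {\<omega> \<in> space M. norm (X T \<omega> - X t \<omega>) < R}"
proof -
  define tight where "tight t R \<delta> \<longleftrightarrow> 0 < \<delta> \<and>
    (\<forall>s\<ge>0. dist s t < \<delta> \<longrightarrow> 1 / 2 \<le> prob {\<omega> \<in> space M. norm (X T \<omega> - X s \<omega>) < R})" for t R \<delta>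
  have "\<exists>R \<delta>. tight t R \<delta>" if t: "0 \<le> t" for t
  proof -
    note [measurable] = random_variable[OF T] random_variable[OF t]
    define A where "A n = {\<omega> \<in> space M. norm (X T \<omega> - X t \<omega>) < real n}" for n
    have A [measurable]: "A n \<in> events" for n unfolding A_def by measurable
    have "(\<lambda>n. prob (A n)) \<longlonglongrightarrow> prob (\<Union>n. A n)"
      by (rule finite_Lim_measure_incseq) (auto simp: A_def incseq_def intro: less_le_trans)
    moreover have "(\<Union>n. A n) = space M"
      using reals_Archimedean2 by (auto simp: A_def)
    ultimately have "(\<lambda>n. prob (A n)) \<longlonglongrightarrow> 1" by (simp add: prob_space)
    then have "\<forall>\<^sub>F n in sequentially. 3 / 4 < prob (A n)" by (rule order_tendstoD) simp
    then obtain n where n: "3 / 4 < prob (A n)" by (auto simp: eventually_sequentially)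
    have "\<forall>\<^sub>F s in at t within {0..}. prob {\<omega> \<in> space M. norm (X s \<omega> - X t \<omega>) > 1} < 1 / 4"
      by (rule order_tendstoD(2)[OF stochastically_continuous[OF t]]) auto
    then obtain \<delta> where \<delta>: "0 < \<delta>"
      "\<And>s. 0 \<le> s \<Longrightarrow> s \<noteq> t \<Longrightarrow> dist s t < \<delta> \<Longrightarrow> prob {\<omega> \<in> space M. norm (X s \<omega> - X t \<omega>) > 1} < 1 / 4"
      unfolding eventually_at by auto
    \<comment> \<open>Outside an event of probability at most 1/4 + 1/4 the increment from \<open>t\<close> to \<open>T\<close> is below \<open>n\<close> and the one
      from \<open>t\<close> to \<open>s\<close> is at most 1.\<close>
    have "1 / 2 \<le> prob {\<omega> \<in> space M. norm (X T \<omega> - X s \<omega>) < real n + 1}" if s: "0 \<le> s" "dist s t < \<delta>" for s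
    proof -
      note [measurable] = random_variable[OF s(1)]
      have "prob {\<omega> \<in> space M. norm (X s \<omega> - X t \<omega>) > 1} < 1 / 4"
        using \<delta>(2)[OF s(1) _ s(2)] by (cases "s = t") auto
      moreover have "prob (A n) \<le> prob ({\<omega> \<in> space M. norm (X T \<omega> - X s \<omega>) < real n + 1} \<union>
          {\<omega> \<in> space M. norm (X s \<omega> - X t \<omega>) > 1})"
      proof (intro finite_measure_mono subsetI)
        fix \<omega> assume "\<omega> \<in> A n"
        then show "\<omega> \<in> {\<omega> \<in> space M. norm (X T \<omega> - X s \<omega>) < real n + 1} \<union>
            {\<omega> \<in> space M. norm (X s \<omega> - X t \<omega>) > 1}"
          using norm_triangle_ineq4[of "X T \<omega> - X t \<omega>" "X s \<omega> - X t \<omega>"] by (auto simp: A_def)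
      qed measurable
      moreover have "\<dots> \<le> prob {\<omega> \<in> space M. norm (X T \<omega> - X s \<omega>) < real n + 1} +
          prob {\<omega> \<in> space M. norm (X s \<omega> - X t \<omega>) > 1}"
        by (rule measure_Un_le) measurable
      ultimately show ?thesis using n by linarith
    qed
    then have "tight t (real n + 1) \<delta>" using \<delta>(1) by (simp add: tight_def)
    then show ?thesis by blast
  qed
  then obtain R \<delta> where "\<And>t. 0 \<le> t \<Longrightarrow> tight t (R t) (\<delta> t)" by metis
  then have loc: "\<And>t. 0 \<le> t \<Longrightarrow> 0 < \<delta> t"
    "\<And>t s. 0 \<le> t \<Longrightarrow> 0 \<le> s \<Longrightarrow> dist s t < \<delta> t \<Longrightarrow> 1 / 2 \<le> prob {\<omega> \<in> space M. norm (X T \<omega> - X s \<omega>) < R t}"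
    by (simp_all add: tight_def)
  have "{0..T} \<subseteq> (\<Union>t\<in>{0..T}. ball t (\<delta> t))" using loc(1) by fastforce
  then obtain F where F: "F \<subseteq> {0..T}" "finite F" "{0..T} \<subseteq> (\<Union>t\<in>F. ball t (\<delta> t))"
    using compactE_image[of "{0..T}" "{0..T}" "\<lambda>t. ball t (\<delta> t)"] by auto
  show ?thesis
  proof (intro exI ballI)
    fix s assume s: "s \<in> {0..T}"
    then obtain t where t: "t \<in> F" "dist s t < \<delta> t" using F(3) by (auto simp: dist_commute)
    define R' where "R' = Max (R ` F)"
    from s have s0: "0 \<le> s" by simp
    note [measurable] = random_variable[OF T] random_variable[OF s0]
    have "1 / 2 \<le> prob {\<omega> \<in> space M. norm (X T \<omega> - X s \<omega>) < R t}"
      using t s F(1) by (intro loc(2)) auto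
    also have "\<dots> \<le> prob {\<omega> \<in> space M. norm (X T \<omega> - X s \<omega>) < R'}"
    proof (rule finite_measure_mono)
      have "R t \<le> R'" using t F(2) by (simp add: R'_def)
      then show "{\<omega> \<in> space M. norm (X T \<omega> - X s \<omega>) < R t} \<subseteq> {\<omega> \<in> space M. norm (X T \<omega> - X s \<omega>) < R'}"
        by auto
    qed measurable
    finally show "1 / 2 \<le> prob {\<omega> \<in> space M. norm (X T \<omega> - X s \<omega>) < Max (R ` F)}"
      unfolding R'_def .
  qed
qed

end

context semi_levy_process
begin

lemma periodic_increments_multiple:
  assumes "0 \<le> s" "0 \<le> t"
  shows "distr M borel (\<lambda>\<omega>. X (t + real k * p) \<omega> - X (s + real k * p) \<omega>) = distr M borel (\<lambda>\<omega>. X t \<omega> - X s \<omega>)"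
proof (induction k)
  case (Suc k)
  have "distr M borel (\<lambda>\<omega>. X (t + real k * p + p) \<omega> - X (s + real k * p + p) \<omega>) =
      distr M borel (\<lambda>\<omega>. X (t + real k * p) \<omega> - X (s + real k * p) \<omega>)"
    using assms period_pos by (intro periodic_increments) auto
  with Suc show ?case by (simp add: algebra_simps)
qed simp

lemma shifted_semi_levy_process:
  assumes s: "0 \<le> s"
  shows "semi_levy_process M (\<lambda>t \<omega>. X (s + t) \<omega> - X s \<omega>) p"
proof -
  interpret shifted: additive_process M "\<lambda>t \<omega>. X (s + t) \<omega> - X s \<omega>"
    by (rule shifted_additive_process[OF s])
  show ?thesis
  proof
    show "0 < p" by (rule period_pos)
    show "distr M borel (\<lambda>\<omega>. X (s + (t + p)) \<omega> - X s \<omega> - (X (s + (u + p)) \<omega> - X s \<omega>)) =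
        distr M borel (\<lambda>\<omega>. X (s + t) \<omega> - X s \<omega> - (X (s + u) \<omega> - X s \<omega>))"
      if "0 \<le> u" "0 \<le> t" for u t
      using periodic_increments[of "s + u" "s + t"] that s by (simp add: add.assoc)
  qed
qed

lemma semi_levy_process_period_multiple:
  assumes "0 < k"
  shows "semi_levy_process M X (real k * p)"
proof
  show "0 < real k * p" using assms period_pos by simp
  show "distr M borel (\<lambda>\<omega>. X (t + real k * p) \<omega> - X (s + real k * p) \<omega>) = distr M borel (\<lambda>\<omega>. X t \<omega> - X s \<omega>)"
    if "0 \<le> s" "0 \<le> t" for s t
    using that by (rule periodic_increments_multiple)
qed

lemma period_walk: "random_walk M (\<lambda>n \<omega>. X (real n * p) \<omega> - X 0 \<omega>)"
proof -
  interpret walk: independent_increment_walk M "\<lambda>n \<omega>. X (real n * p) \<omega> - X 0 \<omega>"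
    by (rule grid_walk[OF period_pos])
  show ?thesis
  proof
    fix i
    show "distr M borel (\<lambda>\<omega>. X (real (Suc i) * p) \<omega> - X 0 \<omega> - (X (real i * p) \<omega> - X 0 \<omega>)) =
        distr M borel (\<lambda>\<omega>. X (real 1 * p) \<omega> - X 0 \<omega> - (X (real 0 * p) \<omega> - X 0 \<omega>))"
    proof -
      have "real (Suc i) * p = p + real i * p" by (simp add: algebra_simps)
      have "distr M borel (\<lambda>\<omega>. X (p + real i * p) \<omega> - X (0 + real i * p) \<omega>) =
          distr M borel (\<lambda>\<omega>. X p \<omega> - X 0 \<omega>)"
        using period_pos by (intro periodic_increments_multiple) auto
      then show ?thesis
        by (simp only: \<open>real (Suc i) * p = p + real i * p\<close> diff_diff_eq2 diff_add_cancel add_0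
            of_nat_1 of_nat_0 mult_1 mult_zero_left)
    qed
  qed
qed

end

section \<open>Excursions within a period\<close>

context semi_levy_process
begin

text \<open>
  The event that the process comes within \<open>a\<close> of its starting point at a dyadic time of the closed period
  from \<open>n p\<close> to \<open>(n + 1) p\<close>. It is measurable by construction, and by right-continuity it contains the corresponding event for all times in
  \<open>{n p..<(n + 1) p}\<close>; it plays the role of the latter in the Borel-Cantelli argument.
\<close>

definition period_visit :: "real \<Rightarrow> nat \<Rightarrow> 'w set" where
  "period_visit a n = (\<Union>m. {\<omega> \<in> space M. \<exists>k\<in>{n * 2 ^ m..Suc n * 2 ^ m}. norm (X (real k * (p / 2 ^ m)) \<omega> - X 0 \<omega>) < a})"

lemma grid_measurable:
  "random_variable borel (\<lambda>\<omega>. X (real k * (p / 2 ^ m)) \<omega> - X 0 \<omega>)"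
  using period_pos by (intro increment_measurable) auto

lemma grid_level_sets:
  "{\<omega> \<in> space M. \<exists>k\<in>{n * 2 ^ m..Suc n * 2 ^ m}. norm (X (real k * (p / 2 ^ m)) \<omega> - X 0 \<omega>) < a} \<in> events"
  using grid_measurable[measurable] by measurable

lemma period_visit_sets [measurable]: "period_visit a n \<in> events"
  unfolding period_visit_def using grid_level_sets by auto

lemma period_visitI:
  assumes \<omega>: "\<omega> \<in> space M" and t: "real n * p \<le> t" "t < real (Suc n) * p"
    and near: "norm (X t \<omega> - X 0 \<omega>) < a"
  shows "\<omega> \<in> period_visit a n"
proof -
  have t0: "0 \<le> t" using t(1) period_pos by (meson mult_nonneg_nonneg of_nat_0_le_iff less_imp_le order_trans)
  have "((\<lambda>s. X s \<omega>) \<longlongrightarrow> X t \<omega>) (at_right t)"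
    using right_continuous[OF \<omega> t0] by (simp add: continuous_within)
  from filterlim_compose[OF this next_grid_point_tendsto[OF period_pos]]
  have "(\<lambda>m. X (next_grid_point (p / 2 ^ m) t) \<omega>) \<longlonglongrightarrow> X t \<omega>" .
  then have "(\<lambda>m. norm (X (next_grid_point (p / 2 ^ m) t) \<omega> - X 0 \<omega>)) \<longlonglongrightarrow> norm (X t \<omega> - X 0 \<omega>)"
    by (intro tendsto_norm tendsto_diff tendsto_const)
  from order_tendstoD(2)[OF this near] obtain m where
    m: "norm (X (next_grid_point (p / 2 ^ m) t) \<omega> - X 0 \<omega>) < a"
    by (auto simp: eventually_sequentially)
  define q where "q = p / 2 ^ m"
  define k where "k = nat (\<lfloor>t / q\<rfloor> + 1)"
  have q: "0 < q" "2 ^ m * q = p" using period_pos by (auto simp: q_def)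
  have fl: "0 \<le> \<lfloor>t / q\<rfloor>" using t0 q(1) by simp
  then have k: "next_grid_point q t = real k * q" by (simp add: next_grid_point_def k_def)
  have "int (n * 2 ^ m) \<le> \<lfloor>t / q\<rfloor>"
  proof -
    have "real (n * 2 ^ m) * q \<le> t" using t(1) q(2) by (simp add: mult.assoc)
    then show ?thesis using q(1) by (simp add: le_floor_iff pos_le_divide_eq)
  qed
  moreover have "\<lfloor>t / q\<rfloor> < int (Suc n * 2 ^ m)"
  proof -
    have "t < real (Suc n * 2 ^ m) * q" using t(2) q(2) by (simp only: of_nat_mult of_nat_power of_nat_numeral mult.assoc)
    then have "t / q < of_int (int (Suc n * 2 ^ m))" using q(1) by (simp only: of_int_of_nat_eq pos_divide_less_eq)
    then show ?thesis by (simp only: floor_less_iff)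
  qed
  ultimately have "k \<in> {n * 2 ^ m..Suc n * 2 ^ m}"
    using fl by (auto simp only: k_def atLeastAtMost_iff)
  then show ?thesis
    using m \<omega> k unfolding period_visit_def q_def by (intro UN_I[of m]) auto
qed

text \<open>
  Ottaviani's inequality applies to the walk on each dyadic grid with a bound \<open>R\<close> that does not depend on
  the grid, nor by periodicity on \<open>n\<close>. The events increase as the grid is refined, so the bound passes to the limit.
\<close>

lemma prob_period_visit_le:
  assumes R: "\<And>t. t \<in> {0..p} \<Longrightarrow> 1 / 2 \<le> prob {\<omega> \<in> space M. norm (X p \<omega> - X t \<omega>) < R}"
  shows "prob (period_visit a n) \<le> 2 * prob {\<omega> \<in> space M. norm (X (real (Suc n) * p) \<omega> - X 0 \<omega>) < a + R}"
proof -
  define A where "A m = {\<omega> \<in> space M. \<exists>k\<in>{n * 2 ^ m..Suc n * 2 ^ m}. norm (X (real k * (p / 2 ^ m)) \<omega> - X 0 \<omega>) < a}" for m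
  have A_events: "A m \<in> events" for m unfolding A_def by (rule grid_level_sets)
  \<comment> \<open>The point \<open>k\<close> of one grid is the point \<open>2 k\<close> of the next finer one.\<close>
  have "A m \<subseteq> A (Suc m)" for m
  proof
    fix \<omega> assume "\<omega> \<in> A m"
    then obtain k where \<omega>: "\<omega> \<in> space M" and k: "k \<in> {n * 2 ^ m..Suc n * 2 ^ m}"
      "norm (X (real k * (p / 2 ^ m)) \<omega> - X 0 \<omega>) < a" by (auto simp: A_def)
    have "2 * k \<in> {n * 2 ^ Suc m..Suc n * 2 ^ Suc m}" using k(1) by auto
    moreover have "norm (X (real (2 * k) * (p / 2 ^ Suc m)) \<omega> - X 0 \<omega>) < a" using k(2) by simp
    ultimately show "\<omega> \<in> A (Suc m)" using \<omega> unfolding A_def by blast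
  qed
  then have "incseq A" by (rule incseq_SucI)
  then have lim: "(\<lambda>m. prob (A m)) \<longlonglongrightarrow> prob (\<Union>m. A m)"
    using A_events by (intro finite_Lim_measure_incseq) auto
  have "prob (A m) \<le> 2 * prob {\<omega> \<in> space M. norm (X (real (Suc n) * p) \<omega> - X 0 \<omega>) < a + R}" for m
  proof -
    define q where "q = p / 2 ^ m"
    have q: "0 < q" "2 ^ m * q = p" using period_pos by (auto simp: q_def)
    have last: "real (Suc n * 2 ^ m) * q = real (Suc n) * p"
      using q(2) by (simp only: of_nat_mult of_nat_power of_nat_numeral mult.assoc)
    interpret walk: independent_increment_walk M "\<lambda>k \<omega>. X (real k * q) \<omega> - X 0 \<omega>"
      by (rule grid_walk[OF q(1)])
    have "1 / 2 \<le> prob {\<omega> \<in> space M. norm ((X (real (Suc n * 2 ^ m) * q) \<omega> - X 0 \<omega>) - (X (real k * q) \<omega> - X 0 \<omega>)) < R}"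
      if k: "k \<in> {n * 2 ^ m..Suc n * 2 ^ m}" for k
    proof -
      define t where "t = real k * q - real n * p"
      have "real (n * 2 ^ m) * q \<le> real k * q" "real k * q \<le> real (Suc n * 2 ^ m) * q"
        using k q(1) by (simp_all only: atLeastAtMost_iff of_nat_le_iff mult_le_cancel_right_pos)
      moreover have "real (n * 2 ^ m) * q = real n * p"
        using q(2) by (simp only: of_nat_mult of_nat_power of_nat_numeral mult.assoc)
      moreover have "real (Suc n) * p = p + real n * p" by (simp add: algebra_simps)
      ultimately have t: "t \<in> {0..p}" "real k * q = t + real n * p" "real (Suc n * 2 ^ m) * q = p + real n * p"
        using last by (auto simp: t_def)
      have "distr M borel (\<lambda>\<omega>. X (p + real n * p) \<omega> - X (t + real n * p) \<omega>) = distr M borel (\<lambda>\<omega>. X p \<omega> - X t \<omega>)"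
        using t(1) period_pos by (intro periodic_increments_multiple) auto
      then have "measure (distr M borel (\<lambda>\<omega>. X (p + real n * p) \<omega> - X (t + real n * p) \<omega>)) (ball 0 R) =
          measure (distr M borel (\<lambda>\<omega>. X p \<omega> - X t \<omega>)) (ball 0 R)" by (rule arg_cong)
      moreover have "random_variable borel (\<lambda>\<omega>. X (p + real n * p) \<omega> - X (t + real n * p) \<omega>)"
        "random_variable borel (\<lambda>\<omega>. X p \<omega> - X t \<omega>)"
        using t(1) period_pos by (auto intro!: increment_measurable)
      ultimately have "prob {\<omega> \<in> space M. norm (X (p + real n * p) \<omega> - X (t + real n * p) \<omega>) < R} =
          prob {\<omega> \<in> space M. norm (X p \<omega> - X t \<omega>) < R}"
        by (simp add: measure_distr vimage_def Int_def conj_commute)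
      then show ?thesis
        using R[OF t(1)] by (simp only: t(2,3) diff_diff_eq2 diff_add_cancel)
    qed
    then have "prob {\<omega> \<in> space M. \<exists>k\<in>{n * 2 ^ m..Suc n * 2 ^ m}. norm (X (real k * q) \<omega> - X 0 \<omega>) < a} \<le>
        2 * prob {\<omega> \<in> space M. norm (X (real (Suc n * 2 ^ m) * q) \<omega> - X 0 \<omega>) < a + R}"
      by (intro walk.ottaviani_inequality) auto
    then show ?thesis unfolding last by (simp only: A_def q_def)
  qed
  then have "prob (\<Union>m. A m) \<le> 2 * prob {\<omega> \<in> space M. norm (X (real (Suc n) * p) \<omega> - X 0 \<omega>) < a + R}"
    by (intro LIMSEQ_le_const2[OF lim]) auto
  then show ?thesis by (simp only: period_visit_def A_def)
qed

lemma summable_period_visits: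
  assumes "\<And>a. summable (\<lambda>n. prob {\<omega> \<in> space M. norm (X (real n * p) \<omega> - X 0 \<omega>) < a})"
  shows "summable (\<lambda>n. prob (period_visit a n))"
proof -
  obtain R where R: "\<And>t. t \<in> {0..p} \<Longrightarrow> 1 / 2 \<le> prob {\<omega> \<in> space M. norm (X p \<omega> - X t \<omega>) < R}"
    using increments_tight[OF less_imp_le[OF period_pos]] by blast
  have "summable (\<lambda>n. prob {\<omega> \<in> space M. norm (X (real (Suc n) * p) \<omega> - X 0 \<omega>) < a + R})"
    using assms[of "a + R"] by (subst summable_Suc_iff)
  then have "summable (\<lambda>n. 2 * prob {\<omega> \<in> space M. norm (X (real (Suc n) * p) \<omega> - X 0 \<omega>) < a + R})"
    by (rule summable_mult)
  then show ?thesis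
    by (rule summable_comparison_test'[where N = 0]) (use prob_period_visit_le[OF R] in simp)
qed

lemma period_index:
  assumes "0 \<le> t"
  shows "real (nat \<lfloor>t / p\<rfloor>) * p \<le> t" "t < real (Suc (nat \<lfloor>t / p\<rfloor>)) * p"
proof -
  have *: "real (nat \<lfloor>t / p\<rfloor>) = of_int \<lfloor>t / p\<rfloor>" using assms period_pos by simp
  show "real (nat \<lfloor>t / p\<rfloor>) * p \<le> t"
    unfolding * using period_pos by (simp add: pos_le_divide_eq[symmetric])
  have "t / p < of_int \<lfloor>t / p\<rfloor> + 1" by linarith
  then show "t < real (Suc (nat \<lfloor>t / p\<rfloor>)) * p"
    using period_pos * by (simp add: pos_divide_less_eq add.commute)
qed

text \<open>
  By Borel-Cantelli the process approaches its starting point within \<open>a\<close> during only finitely many periods.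
\<close>

lemma transient_if_summable:
  assumes sum: "\<And>a. summable (\<lambda>n. prob {\<omega> \<in> space M. norm (X (real n * p) \<omega> - X 0 \<omega>) < a})"
  shows "AE \<omega> in M. filterlim (\<lambda>t. norm (X t \<omega> - X 0 \<omega>)) at_top at_top"
proof -
  have "AE \<omega> in M. \<forall>\<^sub>F n in sequentially. \<omega> \<in> space M - period_visit (real a) n" for a :: nat
    by (rule borel_cantelli_AE1) (auto simp: emeasure_eq_measure intro: summable_period_visits[OF sum])
  then have "AE \<omega> in M. \<forall>a::nat. \<forall>\<^sub>F n in sequentially. \<omega> \<in> space M - period_visit (real a) n"
    by (simp add: AE_all_countable)
  then show ?thesis
  proof eventually_elim
    case (elim \<omega>)
    show ?case unfolding filterlim_at_top
    proof
      fix Z :: real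
      obtain a :: nat where a: "Z \<le> real a" using real_arch_simple by blast
      obtain N where N: "\<And>n. N \<le> n \<Longrightarrow> \<omega> \<in> space M - period_visit (real a) n"
        using elim[rule_format, of a] by (auto simp: eventually_sequentially)
      have "Z \<le> norm (X t \<omega> - X 0 \<omega>)" if t: "real N * p \<le> t" for t
      proof (rule ccontr)
        assume "\<not> Z \<le> norm (X t \<omega> - X 0 \<omega>)"
        then have near: "norm (X t \<omega> - X 0 \<omega>) < real a" using a by simp
        have t0: "0 \<le> t" using t period_pos by (meson mult_nonneg_nonneg of_nat_0_le_iff less_imp_le order_trans)
        have "\<omega> \<in> period_visit (real a) (nat \<lfloor>t / p\<rfloor>)"
          using N[of N] by (intro period_visitI[OF _ period_index[OF t0] near]) simp
        moreover have "N \<le> nat \<lfloor>t / p\<rfloor>"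
          using t t0 period_pos by (simp add: le_nat_iff le_floor_iff pos_le_divide_eq)
        ultimately show False using N by blast
      qed
      then show "\<forall>\<^sub>F t in at_top. Z \<le> norm (X t \<omega> - X 0 \<omega>)"
        unfolding eventually_at_top_linorder by blast
    qed
  qed
qed

text \<open>
  At a time of period number \<open>n\<close> the process is in the ball, up to a null set, only on \<open>period_visit a n\<close>, so each
  period contributes at most \<open>p\<close> times the probability of that event.
\<close>

lemma finite_expected_occupation_if_summable:
  assumes sum: "\<And>a. summable (\<lambda>n. prob {\<omega> \<in> space M. norm (X (real n * p) \<omega> - X 0 \<omega>) < a})"
  shows "(\<integral>\<^sup>+ t\<in>{0..}. emeasure M {\<omega> \<in> space M. X t \<omega> \<in> ball 0 a} \<partial>lborel) < \<infinity>"
proof -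
  define J where "J n = {real n * p..<real (Suc n) * p}" for n
  have "(\<integral>\<^sup>+ t\<in>{0..}. emeasure M {\<omega> \<in> space M. X t \<omega> \<in> ball 0 a} \<partial>lborel) \<le>
      (\<integral>\<^sup>+ t. (\<Sum>n. indicator (J n) t * ennreal (prob (period_visit a n))) \<partial>lborel)"
  proof (rule nn_integral_mono)
    fix t :: real
    show "emeasure M {\<omega> \<in> space M. X t \<omega> \<in> ball 0 a} * indicator {0..} t \<le>
        (\<Sum>n. indicator (J n) t * ennreal (prob (period_visit a n)))"
    proof (cases "0 \<le> t")
      case True
      define n where "n = nat \<lfloor>t / p\<rfloor>"
      have n: "real n * p \<le> t" "t < real (Suc n) * p" using period_index[OF True] by (auto simp: n_def)
      have "emeasure M {\<omega> \<in> space M. X t \<omega> \<in> ball 0 a} \<le> emeasure M (period_visit a n)"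
      proof (rule emeasure_mono_AE)
        show "AE \<omega> in M. \<omega> \<in> {\<omega> \<in> space M. X t \<omega> \<in> ball 0 a} \<longrightarrow> \<omega> \<in> period_visit a n"
          using start
        proof eventually_elim
          case (elim \<omega>)
          then show ?case using period_visitI[OF _ n, of \<omega> a] by auto
        qed
      qed simp
      also have "\<dots> = indicator (J n) t * ennreal (prob (period_visit a n))"
        using n by (simp add: J_def emeasure_eq_measure)
      also have "\<dots> \<le> (\<Sum>n. indicator (J n) t * ennreal (prob (period_visit a n)))"
        using sum_le_suminf[OF summableI, of "{n}" "\<lambda>n. indicator (J n) t * ennreal (prob (period_visit a n))"]
        by (simp only: sum.insert sum.empty finite.intros finite_insert empty_iff simp_thms add_0_right zero_le)
      finally show ?thesis using True by simp
    qed simp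
  qed
  also have "\<dots> = (\<Sum>n. \<integral>\<^sup>+ t. indicator (J n) t * ennreal (prob (period_visit a n)) \<partial>lborel)"
    by (intro nn_integral_suminf) (auto simp: J_def)
  also have "\<dots> = (\<Sum>n. ennreal (p * prob (period_visit a n)))"
  proof (rule suminf_cong)
    fix n
    have "(\<integral>\<^sup>+ t. indicator (J n) t * ennreal (prob (period_visit a n)) \<partial>lborel) =
        emeasure lborel (J n) * ennreal (prob (period_visit a n))"
      by (subst nn_integral_multc) (auto simp: J_def)
    also have "emeasure lborel (J n) = ennreal p"
      using period_pos by (simp add: J_def algebra_simps)
    finally show "(\<integral>\<^sup>+ t. indicator (J n) t * ennreal (prob (period_visit a n)) \<partial>lborel) = ennreal (p * prob (period_visit a n))"
      using period_pos by (simp add: ennreal_mult)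
  qed
  also have "\<dots> = ennreal (\<Sum>n. p * prob (period_visit a n))"
    using period_pos by (intro suminf_ennreal2 summable_mult summable_period_visits[OF sum]) auto
  also have "\<dots> < \<infinity>" by simp
  finally show ?thesis .
qed

end

section \<open>The dichotomy\<close>

context semi_levy_process
begin

text \<open>
  The dichotomy for the walk at multiples of the period: either the expected number of visits is infinite for every
  radius, and the walk returns, or it is finite for every radius.
\<close>

lemma period_walk_returns_or_summable:
  "(AE \<omega> in M. \<forall>e>0. \<exists>\<^sub>F n in sequentially. norm (X (real n * p) \<omega> - X 0 \<omega>) < e) \<or>
   (\<forall>a. summable (\<lambda>n. prob {\<omega> \<in> space M. norm (X (real n * p) \<omega> - X 0 \<omega>) < a}))"
proof -
  interpret walk: random_walk M "\<lambda>n \<omega>. X (real n * p) \<omega> - X 0 \<omega>" by (rule period_walk)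
  show ?thesis using walk.AE_infinitely_often_near_0 walk.summable_visits by blast
qed

lemma transient_if_increments_transient:
  assumes "AE \<omega> in M. filterlim (\<lambda>t. norm (X (s + t) \<omega> - X s \<omega>)) at_top at_top"
  shows "transient M X"
  unfolding transient_def using assms
  by eventually_elim (rule norm_at_top_of_shifted)

text \<open>
  The process restarted at time \<open>s\<close> is again semi-Levy, so the dichotomy applies to it. If it did not return,
  it would be transient, and with it the process itself.
\<close>

lemma returns_if_not_transient:
  assumes "\<not> transient M X" and s: "0 \<le> s"
  shows "AE \<omega> in M. \<forall>e>0. \<exists>\<^sub>F n in sequentially. norm (X (s + real n * p) \<omega> - X s \<omega>) < e"
proof -
  interpret shifted: semi_levy_process M "\<lambda>t \<omega>. X (s + t) \<omega> - X s \<omega>" p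
    by (rule shifted_semi_levy_process[OF s])
  have "\<not> (AE \<omega> in M. filterlim (\<lambda>t. norm (X (s + t) \<omega> - X s \<omega> - (X (s + 0) \<omega> - X s \<omega>))) at_top at_top)"
    using assms transient_if_increments_transient[of s] by auto
  then show ?thesis
    using shifted.period_walk_returns_or_summable shifted.transient_if_summable by auto
qed

end

section \<open>Occupation times\<close>

context additive_process
begin

text \<open>
  Right-continuity makes the process a pointwise limit of processes that are constant in time between
  grid points, so it is jointly measurable and Fubini's theorem applies. The time \<open>max 0 t\<close> avoids negative
  times, about which nothing is assumed.
\<close>

lemma process_measurable:
  "(\<lambda>x. X (max 0 (fst x)) (snd x)) \<in> borel_measurable (lborel \<Otimes>\<^sub>M M)"
proof (rule borel_measurable_LIMSEQ_metric)
  fix m :: nat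
  define \<delta> :: real where "\<delta> = 1 / 2 ^ m"
  have \<delta>: "0 < \<delta>" by (simp add: \<delta>_def)
  have "(\<lambda>x. X (real (Suc k) * \<delta>) (snd x)) \<in> borel_measurable (lborel \<Otimes>\<^sub>M M)" for k
    using random_variable[of "real (Suc k) * \<delta>"] \<delta> by (intro measurable_compose[OF measurable_snd]) auto
  then have "(\<lambda>x. X (real (Suc (nat \<lfloor>max 0 (fst x) / \<delta>\<rfloor>)) * \<delta>) (snd x)) \<in> borel_measurable (lborel \<Otimes>\<^sub>M M)"
    by (rule measurable_compose_countable) measurable
  moreover have "next_grid_point \<delta> (max 0 t) = real (Suc (nat \<lfloor>max 0 t / \<delta>\<rfloor>)) * \<delta>" for t
    using \<delta> by (simp add: next_grid_point_def add.commute)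
  ultimately show "(\<lambda>x. X (next_grid_point (1 / 2 ^ m) (max 0 (fst x))) (snd x)) \<in> borel_measurable (lborel \<Otimes>\<^sub>M M)"
    by (simp only: \<delta>_def)
next
  fix x :: "real \<times> 'w" assume "x \<in> space (lborel \<Otimes>\<^sub>M M)"
  then have "snd x \<in> space M" by (auto simp: space_pair_measure)
  then have "((\<lambda>s. X s (snd x)) \<longlongrightarrow> X (max 0 (fst x)) (snd x)) (at_right (max 0 (fst x)))"
    using right_continuous[of "snd x" "max 0 (fst x)"] by (simp add: continuous_within)
  from filterlim_compose[OF this next_grid_point_tendsto[of 1]]
  show "(\<lambda>m. X (next_grid_point (1 / 2 ^ m) (max 0 (fst x))) (snd x)) \<longlonglongrightarrow> X (max 0 (fst x)) (snd x)" by simp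
qed

lemma shifted_process_measurable:
  assumes "0 \<le> c"
  shows "(\<lambda>x. X (max 0 (fst x) + c) (snd x)) \<in> borel_measurable (lborel \<Otimes>\<^sub>M M)"
proof -
  have "(\<lambda>x. (max 0 (fst x) + c, snd x)) \<in> lborel \<Otimes>\<^sub>M M \<rightarrow>\<^sub>M lborel \<Otimes>\<^sub>M M" by measurable
  from measurable_compose[OF this process_measurable] show ?thesis using assms by simp
qed

lemma path_measurable:
  assumes "\<omega> \<in> space M"
  shows "(\<lambda>t. X (max 0 t) \<omega>) \<in> borel_measurable lborel"
proof -
  have "(\<lambda>t. (t, \<omega>)) \<in> lborel \<rightarrow>\<^sub>M lborel \<Otimes>\<^sub>M M" using assms by measurable
  from measurable_compose[OF this process_measurable] show ?thesis by simp
qed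

lemma expected_occupation:
  "(\<integral>\<^sup>+ t\<in>{0..}. emeasure M {\<omega> \<in> space M. X t \<omega> \<in> ball 0 a} \<partial>lborel) =
   (\<integral>\<^sup>+ \<omega>. (\<integral>\<^sup>+ t\<in>{0..}. indicator (ball 0 a) (X t \<omega>) \<partial>lborel) \<partial>M)"
proof -
  interpret pair_sigma_finite lborel M ..
  define f :: "real \<Rightarrow> 'w \<Rightarrow> ennreal" where "f t \<omega> = indicator (ball 0 a) (X (max 0 t) \<omega>) * indicator {0..} t" for t \<omega>
  have f: "f t \<omega> = indicator (ball 0 a) (X t \<omega>) * indicator {0..} t" for t \<omega>
    by (simp add: f_def indicator_def)
  have "(\<lambda>x. indicator (ball 0 a) (X (max 0 (fst x)) (snd x)) :: ennreal) \<in> borel_measurable (lborel \<Otimes>\<^sub>M M)"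
    by (rule measurable_compose[OF process_measurable]) (rule borel_measurable_indicator, simp)
  moreover have "(\<lambda>x. indicator {0 :: real..} (fst x) :: ennreal) \<in> borel_measurable (lborel \<Otimes>\<^sub>M M)"
    by (rule measurable_compose[OF measurable_fst]) (rule borel_measurable_indicator, simp)
  ultimately have "(\<lambda>x. f (fst x) (snd x)) \<in> borel_measurable (lborel \<Otimes>\<^sub>M M)"
    unfolding f_def by measurable
  then have "(\<integral>\<^sup>+ t. \<integral>\<^sup>+ \<omega>. f t \<omega> \<partial>M \<partial>lborel) = (\<integral>\<^sup>+ \<omega>. \<integral>\<^sup>+ t. f t \<omega> \<partial>lborel \<partial>M)"
    using Fubini'[of f] by (simp add: split_beta')
  moreover have "(\<integral>\<^sup>+ \<omega>. f t \<omega> \<partial>M) = emeasure M {\<omega> \<in> space M. X t \<omega> \<in> ball 0 a} * indicator {0..} t" for t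
  proof (cases "0 \<le> t")
    case True
    have "(\<integral>\<^sup>+ \<omega>. f t \<omega> \<partial>M) = (\<integral>\<^sup>+ \<omega>. indicator {\<omega> \<in> space M. X t \<omega> \<in> ball 0 a} \<omega> \<partial>M)"
      using True by (intro nn_integral_cong) (simp add: f indicator_def)
    also have "\<dots> = emeasure M {\<omega> \<in> space M. X t \<omega> \<in> ball 0 a}"
      using random_variable[OF True] by (intro nn_integral_indicator) (simp add: pred_def)
    finally show ?thesis using True by simp
  qed (simp add: f)
  ultimately show ?thesis by (simp add: f)
qed

lemma not_transient_if_returns:
  assumes "AE \<omega> in M. \<exists>\<^sub>F t in at_top. norm (X t \<omega> - X 0 \<omega>) < e"
  shows "\<not> transient M X"
proof
  assume "transient M X"
  then have "AE \<omega> in M. False"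
    unfolding transient_def using assms start
  proof eventually_elim
    case (elim \<omega>)
    then have "\<forall>\<^sub>F t in at_top. e \<le> norm (X t \<omega> - X 0 \<omega>)" by (simp add: filterlim_at_top)
    with elim(2) show False by (simp add: frequently_def not_less)
  qed
  then show False by simp
qed

lemma finite_occupation_if_transient:
  assumes "transient M X"
  shows "AE \<omega> in M. (\<integral>\<^sup>+ t\<in>{0..}. indicator (ball 0 a) (X t \<omega>) \<partial>lborel) < \<infinity>"
  using assms unfolding transient_def
proof eventually_elim
  case (elim \<omega>)
  then have "\<forall>\<^sub>F t in at_top. a \<le> norm (X t \<omega>)" by (simp add: filterlim_at_top)
  then obtain T where T: "\<And>t. T \<le> t \<Longrightarrow> a \<le> norm (X t \<omega>)" unfolding eventually_at_top_linorder by blast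
  have "(\<integral>\<^sup>+ t\<in>{0..}. indicator (ball 0 a) (X t \<omega>) \<partial>lborel) \<le> (\<integral>\<^sup>+ t. indicator {0..T} t \<partial>lborel)"
  proof (rule nn_integral_mono)
    show "indicator (ball 0 a) (X t \<omega>) * indicator {0..} t \<le> (indicator {0..T} t :: ennreal)" for t
      using T[of t] by (auto simp: indicator_def not_le)
  qed
  also have "\<dots> < \<infinity>" by (simp add: emeasure_lborel_Icc_eq)
  finally show ?case .
qed

end

context semi_levy_process
begin

lemma recurrent_from_if_returns:
  assumes "AE \<omega> in M. \<forall>e>0. \<exists>\<^sub>F n in sequentially. norm (X (s + real n * p) \<omega> - X s \<omega>) < e"
  shows "recurrent_from M X s"
  unfolding recurrent_from_def using assms
proof eventually_elim
  case (elim \<omega>)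
  then have "\<forall>e>0. \<exists>\<^sub>F t in at_top. norm (X t \<omega> - X s \<omega>) < e"
    by (auto intro: frequently_along[OF _ arithmetic_progression_at_top[OF period_pos]])
  then show ?case by (simp only: Liminf_norm_eq_0_iff[OF trivial_limit_at_top_linorder])
qed

lemma not_transient_if_recurrent_from_0:
  assumes "recurrent_from M X 0"
  shows "\<not> transient M X"
proof (rule not_transient_if_returns)
  show "AE \<omega> in M. \<exists>\<^sub>F t in at_top. norm (X t \<omega> - X 0 \<omega>) < 1"
    using assms unfolding recurrent_from_def by eventually_elim (simp add: Liminf_norm_eq_0_iff[OF trivial_limit_at_top_linorder])
qed

lemma recurrent_iff_not_transient: "recurrent M X \<longleftrightarrow> \<not> transient M X"
proof
  assume "recurrent M X"
  then show "\<not> transient M X"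
    by (intro not_transient_if_recurrent_from_0) (simp add: recurrent_def)
next
  assume "\<not> transient M X"
  then show "recurrent M X"
    unfolding recurrent_def by (intro allI impI recurrent_from_if_returns returns_if_not_transient)
qed

lemma finite_expected_occupation_if_transient:
  assumes "transient M X"
  shows "(\<integral>\<^sup>+ t\<in>{0..}. emeasure M {\<omega> \<in> space M. X t \<omega> \<in> ball 0 a} \<partial>lborel) < \<infinity>"
proof (rule finite_expected_occupation_if_summable)
  have "\<not> recurrent_from M X 0" using assms not_transient_if_recurrent_from_0 by blast
  then show "summable (\<lambda>n. prob {\<omega> \<in> space M. norm (X (real n * p) \<omega> - X 0 \<omega>) < b})" for b
    using period_walk_returns_or_summable recurrent_from_if_returns[of 0] by auto
qed

text \<open>
  For each \<open>u\<close>, almost every path returns at the times \<open>u + n p\<close> to within \<open>a / 2\<close> of \<open>X u\<close>, infinitely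
  often. By Fubini almost every path does so for almost every \<open>u\<close>. As paths are right-continuous and
  start at \<open>0\<close>, on some interval \<open>0 < u < \<delta>\<close> also \<open>X u\<close> is within \<open>a / 2\<close> of \<open>0\<close>, and then infinitely many of the times
  \<open>u + n p\<close> are spent within \<open>a\<close> of \<open>0\<close>. Integrating the number of such times over \<open>u\<close> gives a lower bound
  for the occupation time.
\<close>

lemma infinite_occupation_if_not_transient:
  assumes nt: "\<not> transient M X" and a: "0 < a"
  shows "AE \<omega> in M. (\<integral>\<^sup>+ t\<in>{0..}. indicator (ball 0 a) (X t \<omega>) \<partial>lborel) = \<infinity>"
proof -
  interpret pair_sigma_finite lborel M ..
  define P where "P u \<omega> \<longleftrightarrow> norm (X (max 0 u) \<omega>) < a / 2 \<longrightarrow> (\<forall>N. \<exists>n\<ge>N. norm (X (max 0 u + real n * p) \<omega>) < a)"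
    for u \<omega>
  have [measurable]: "(\<lambda>x. X (max 0 (fst x) + real n * p) (snd x)) \<in> borel_measurable (lborel \<Otimes>\<^sub>M M)" for n
    using period_pos by (intro shifted_process_measurable) simp
  note [measurable] = process_measurable
  have "{x \<in> space (lborel \<Otimes>\<^sub>M M). P (fst x) (snd x)} \<in> sets (lborel \<Otimes>\<^sub>M M)"
    unfolding P_def by measurable
  moreover have "AE \<omega> in M. P u \<omega>" for u
    using returns_if_not_transient[OF nt max.cobounded1[of 0 u]]
  proof eventually_elim
    case (elim \<omega>)
    have "\<exists>\<^sub>F n in sequentially. norm (X (max 0 u + real n * p) \<omega> - X (max 0 u) \<omega>) < a / 2"
      using elim half_gt_zero[OF a] by blast
    then have "\<exists>\<^sub>F n in sequentially. norm (X (max 0 u + real n * p) \<omega>) < a" if "norm (X (max 0 u) \<omega>) < a / 2"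
    proof (rule frequently_elim1)
      fix n assume "norm (X (max 0 u + real n * p) \<omega> - X (max 0 u) \<omega>) < a / 2"
      with that show "norm (X (max 0 u + real n * p) \<omega>) < a"
        using norm_triangle_sub[of "X (max 0 u + real n * p) \<omega>" "X (max 0 u) \<omega>"] by linarith
    qed
    then show ?case by (auto simp: P_def frequently_sequentially)
  qed
  ultimately have "AE \<omega> in M. AE u in lborel. P u \<omega>"
    using AE_commute[of P] by simp
  then show ?thesis using start AE_space
  proof eventually_elim
    case (elim \<omega>)
    define g :: "real \<Rightarrow> ennreal" where "g t = indicator (ball 0 a) (X (max 0 t) \<omega>)" for t
    have g [measurable]: "g \<in> borel_measurable borel"
      using measurable_compose[OF path_measurable[OF elim(3)] borel_measurable_indicator[of "ball 0 a"]]
      unfolding g_def by simp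
    have "((\<lambda>s. norm (X s \<omega>)) \<longlongrightarrow> norm (X 0 \<omega>)) (at_right 0)"
      using right_continuous[OF elim(3), of 0] by (auto simp: continuous_within intro: tendsto_norm)
    then have "\<forall>\<^sub>F s in at_right 0. norm (X s \<omega>) < a / 2"
      by (rule order_tendstoD) (use elim(2) a in simp)
    then obtain d where d: "0 < d" "\<And>s. 0 < s \<Longrightarrow> s < d \<Longrightarrow> norm (X s \<omega>) < a / 2"
      unfolding eventually_at_right_field by blast
    \<comment> \<open>\<open>\<delta> \<le> p\<close> makes the intervals \<open>J n\<close> below, one in each period, disjoint.\<close>
    define \<delta> where "\<delta> = min d p"
    have \<delta>: "0 < \<delta>" "\<delta> \<le> p" "\<delta> \<le> d" using d(1) period_pos by (auto simp: \<delta>_def)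
    define J where "J n = {real n * p<..<real n * p + \<delta>}" for n
    have disj: "m = n" if "t \<in> J m" "t \<in> J n" for t m n
    proof -
      have "\<lfloor>t / p\<rfloor> = int k" if "t \<in> J k" for k
        using that \<delta> period_pos by (simp add: J_def floor_eq_iff field_simps)
      then show ?thesis using that by (metis of_nat_eq_iff)
    qed
    have "\<infinity> = (\<integral>\<^sup>+ u. \<infinity> * indicator {0<..<\<delta>} u \<partial>lborel)"
      using \<delta>(1) by (subst nn_integral_cmult_indicator) (auto simp: ennreal_top_mult)
    also have "\<dots> = (\<integral>\<^sup>+ u. (\<Sum>n. indicator {0<..<\<delta>} u * g (real n * p + u)) \<partial>lborel)"
    proof (rule nn_integral_cong_AE)
      show "AE u in lborel. \<infinity> * indicator {0<..<\<delta>} u = (\<Sum>n. indicator {0<..<\<delta>} u * g (real n * p + u))"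
        using elim(1)
      proof eventually_elim
        case (elim u)
        show ?case
        proof (cases "u \<in> {0<..<\<delta>}")
          case True
          then have "norm (X u \<omega>) < a / 2" using d(2) \<delta>(3) by auto
          then have "\<exists>\<^sub>F n in sequentially. X (u + real n * p) \<omega> \<in> ball 0 a"
            using elim True by (simp add: P_def frequently_sequentially)
          then have "(\<Sum>n. indicator (ball 0 a) (X (u + real n * p) \<omega>) :: ennreal) = \<infinity>"
            by (rule suminf_indicator_infinitely_often)
          moreover have "g (real n * p + u) = indicator (ball 0 a) (X (u + real n * p) \<omega>)" for n
            using True period_pos by (simp add: g_def add.commute max_absorb2)
          ultimately show ?thesis using True by simp
        qed simp
      qed
    qed
    also have "\<dots> = (\<Sum>n. \<integral>\<^sup>+ u. indicator {0<..<\<delta>} u * g (real n * p + u) \<partial>lborel)"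
      by (rule nn_integral_suminf) measurable
    also have "\<dots> = (\<Sum>n. \<integral>\<^sup>+ t. indicator (J n) t * g t \<partial>lborel)"
    proof (rule suminf_cong)
      fix n
      have "(\<integral>\<^sup>+ t. indicator (J n) t * g t \<partial>lborel) =
          (\<integral>\<^sup>+ u. indicator (J n) (real n * p + u) * g (real n * p + u) \<partial>lborel)"
        by (subst nn_integral_real_affine[where c = 1 and t = "real n * p"]) (auto simp: J_def)
      also have "\<dots> = (\<integral>\<^sup>+ u. indicator {0<..<\<delta>} u * g (real n * p + u) \<partial>lborel)"
        by (intro nn_integral_cong) (simp add: J_def indicator_def)
      finally show "(\<integral>\<^sup>+ u. indicator {0<..<\<delta>} u * g (real n * p + u) \<partial>lborel) = (\<integral>\<^sup>+ t. indicator (J n) t * g t \<partial>lborel)"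
        by simp
    qed
    also have "\<dots> = (\<integral>\<^sup>+ t. (\<Sum>n. indicator (J n) t * g t) \<partial>lborel)"
      by (rule nn_integral_suminf[symmetric]) (auto simp: J_def)
    also have "\<dots> \<le> (\<integral>\<^sup>+ t\<in>{0..}. indicator (ball 0 a) (X t \<omega>) \<partial>lborel)"
    proof (rule nn_integral_mono)
      fix t :: real
      show "(\<Sum>n. indicator (J n) t * g t) \<le> indicator (ball 0 a) (X t \<omega>) * indicator {0..} t"
      proof (cases "\<exists>n. t \<in> J n")
        case True
        then obtain n where n: "t \<in> J n" by blast
        have "0 \<le> real n * p" using period_pos by simp
        then have "0 \<le> t" using n by (simp add: J_def)
        have "(\<Sum>n. indicator (J n) t * g t) = (\<Sum>k\<in>{n}. indicator (J k) t * g t)"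
          by (rule suminf_finite) (use disj[OF n] in \<open>auto simp: indicator_def\<close>)
        then show ?thesis using n \<open>0 \<le> t\<close> by (simp add: g_def max_absorb2)
      qed simp
    qed
    finally show ?case by (simp add: top_unique)
  qed
qed

text \<open>
  A multiple of a period is a period. With the common multiple \<open>b h = k p\<close> as the period, the returns to \<open>X (m h)\<close> occur at
  times \<open>m h + n (b h)\<close>, which are multiples of \<open>h\<close>.
\<close>

lemma recurrent_seq_if_not_transient:
  assumes nt: "\<not> transient M X" and h: "0 < h" and b: "0 < b" and per: "real b * h = real k * p"
  shows "recurrent_seq M (\<lambda>n. X (real n * h))"
  unfolding recurrent_seq_def
proof
  fix m
  have "0 < real k * p" using h b per by (metis mult_pos_pos of_nat_0_less_iff)
  then have "0 < k" using period_pos by (cases k) auto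
  then interpret multiple: semi_levy_process M X "real k * p"
    by (rule semi_levy_process_period_multiple)
  have "AE \<omega> in M. \<forall>e>0. \<exists>\<^sub>F n in sequentially. norm (X (real m * h + real n * (real k * p)) \<omega> - X (real m * h) \<omega>) < e"
    using h by (intro multiple.returns_if_not_transient[OF nt]) simp
  then show "AE \<omega> in M. liminf (\<lambda>n. ereal (norm (X (real n * h) \<omega> - X (real m * h) \<omega>))) = 0"
  proof eventually_elim
    case (elim \<omega>)
    have "filterlim (\<lambda>n. m + n * b) sequentially sequentially"
      using b by (intro filterlim_subseq) (auto simp: strict_mono_def)
    moreover have "real m * h + real n * (real k * p) = real (m + n * b) * h" for n
      using per by (simp add: algebra_simps)
    then have "\<forall>e>0. \<exists>\<^sub>F n in sequentially. norm (X (real (m + n * b) * h) \<omega> - X (real m * h) \<omega>) < e"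
      using elim by (simp only:)
    ultimately have "\<forall>e>0. \<exists>\<^sub>F n in sequentially. norm (X (real n * h) \<omega> - X (real m * h) \<omega>) < e"
      using frequently_along[where g = "\<lambda>n. m + n * b"
          and P = "\<lambda>n. norm (X (real n * h) \<omega> - X (real m * h) \<omega>) < _"] by blast
    then show ?case by (simp only: Liminf_norm_eq_0_iff[OF sequentially_bot])
  qed
qed

lemma not_transient_if_recurrent_seq:
  assumes h: "0 < h" and rec: "recurrent_seq M (\<lambda>n. X (real n * h))"
  shows "\<not> transient M X"
proof (rule not_transient_if_returns)
  have "AE \<omega> in M. liminf (\<lambda>n. ereal (norm (X (real n * h) \<omega> - X (real 0 * h) \<omega>))) = 0"
    using rec unfolding recurrent_seq_def by blast
  then show "AE \<omega> in M. \<exists>\<^sub>F t in at_top. norm (X t \<omega> - X 0 \<omega>) < 1"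
  proof eventually_elim
    case (elim \<omega>)
    then have "\<exists>\<^sub>F n in sequentially. norm (X (0 + real n * h) \<omega> - X 0 \<omega>) < 1"
      by (simp add: Liminf_norm_eq_0_iff)
    then show ?case by (rule frequently_along[OF _ arithmetic_progression_at_top[OF h]])
  qed
qed

end

section \<open>Recurrence and transience of semi-Levy processes\<close>

theorem theorem1p4:
  fixes M :: "'w measure" and X :: "real \<Rightarrow> 'w \<Rightarrow> real ^ 'd" and p :: real
  assumes "semi_levy_process M X p"
  shows
    "(recurrent_from M X 0 \<longrightarrow> recurrent M X) \<and>
     ((recurrent M X \<or> transient M X) \<and> \<not> (recurrent M X \<and> transient M X)) \<and>
     (recurrent M X \<longleftrightarrow>
        (\<forall>a>0. (\<integral>\<^sup>+ t\<in>{0..}. emeasure M {\<omega> \<in> space M. X t \<omega> \<in> ball 0 a} \<partial>lborel) = \<infinity>)) \<and>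
     (recurrent M X \<longleftrightarrow>
        (\<forall>a>0. AE \<omega> in M. (\<integral>\<^sup>+ t\<in>{0..}. indicator (ball 0 a) (X t \<omega>) \<partial>lborel) = \<infinity>)) \<and>
     (transient M X \<longleftrightarrow>
        (\<forall>a>0. (\<integral>\<^sup>+ t\<in>{0..}. emeasure M {\<omega> \<in> space M. X t \<omega> \<in> ball 0 a} \<partial>lborel) < \<infinity>)) \<and>
     (transient M X \<longleftrightarrow>
        (\<forall>a>0. AE \<omega> in M. (\<integral>\<^sup>+ t\<in>{0..}. indicator (ball 0 a) (X t \<omega>) \<partial>lborel) < \<infinity>)) \<and>
     (\<forall>h. 0 < h \<and> h \<in> (\<lambda>r. p * r) ` \<rat> \<longrightarrow>
        (recurrent M X \<longleftrightarrow> recurrent_seq M (\<lambda>n. X (real n * h))))"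
proof -
  interpret semi_levy_process M X p by (rule assms)
  define I where "I a = ( \<integral>\<^sup>+ t\<in>{0..}. emeasure M {\<omega> \<in> space M. X t \<omega> \<in> ball 0 a} \<partial>lborel)" for a
  define Occ where "Occ a \<omega> = ( \<integral>\<^sup>+ t\<in>{0..}. indicator (ball 0 a) (X t \<omega>) \<partial>lborel)" for a \<omega>
  have O_infinite: "AE \<omega> in M. Occ a \<omega> = \<infinity>" if "\<not> transient M X" "0 < a" for a
    using that unfolding Occ_def by (rule infinite_occupation_if_not_transient)
  have O_finite: "AE \<omega> in M. Occ a \<omega> < \<infinity>" if "transient M X" for a
    using that unfolding Occ_def by (rule finite_occupation_if_transient)
  have O_exclusive: "\<not> ((AE \<omega> in M. Occ 1 \<omega> = \<infinity>) \<and> (AE \<omega> in M. Occ 1 \<omega> < \<infinity>))"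
  proof
    assume "(AE \<omega> in M. Occ 1 \<omega> = \<infinity>) \<and> (AE \<omega> in M. Occ 1 \<omega> < \<infinity>)"
    then have "AE \<omega> in M. Occ 1 \<omega> = \<infinity>" "AE \<omega> in M. Occ 1 \<omega> < \<infinity>" by auto
    then have "AE \<omega> in M. False" by eventually_elim simp
    then show False by simp
  qed
  have I_infinite: "I a = \<infinity>" if "\<not> transient M X" "0 < a" for a
  proof -
    have "I a = (\<integral>\<^sup>+ \<omega>. Occ a \<omega> \<partial>M)" unfolding I_def Occ_def by (rule expected_occupation)
    also have "\<dots> = (\<integral>\<^sup>+ \<omega>. \<infinity> \<partial>M)" by (rule nn_integral_cong_AE[OF O_infinite[OF that]])
    also have "\<dots> = \<infinity>" by (simp add: emeasure_space_1)
    finally show ?thesis .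
  qed
  have I_finite: "I a < \<infinity>" if "transient M X" for a
    using that unfolding I_def by (rule finite_expected_occupation_if_transient)
  have i: "recurrent_from M X 0 \<longrightarrow> recurrent M X"
    using not_transient_if_recurrent_from_0 recurrent_iff_not_transient by simp
  have iii: "recurrent M X \<longleftrightarrow> (\<forall>a>0. I a = \<infinity>)"
    using I_infinite I_finite[of 1] zero_less_one less_irrefl unfolding recurrent_iff_not_transient by metis
  have iv: "recurrent M X \<longleftrightarrow> (\<forall>a>0. AE \<omega> in M. Occ a \<omega> = \<infinity>)"
    using O_infinite O_finite[of 1] O_exclusive zero_less_one unfolding recurrent_iff_not_transient by blast
  have v: "transient M X \<longleftrightarrow> (\<forall>a>0. I a < \<infinity>)"
    using I_infinite[of 1] I_finite zero_less_one less_irrefl by metis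
  have vi: "transient M X \<longleftrightarrow> (\<forall>a>0. AE \<omega> in M. Occ a \<omega> < \<infinity>)"
    using O_infinite[of 1] O_finite O_exclusive zero_less_one by blast
  have vii: "recurrent M X \<longleftrightarrow> recurrent_seq M (\<lambda>n. X (real n * h))"
    if h: "0 < h" "h \<in> (\<lambda>r. p * r) ` \<rat>" for h
  proof -
    obtain r where r: "r \<in> \<rat>" "h = p * r" using h(2) by blast
    then have "0 < r" using h(1) period_pos by (simp add: zero_less_mult_iff)
    obtain k b :: nat where "b \<noteq> 0" "\<bar>r\<bar> = real k / real b" using Rats_abs_nat_div_natE[OF r(1)] by metis
    then have b: "0 < b" "real b * h = real k * p" using \<open>0 < r\<close> r(2) by (simp_all add: field_simps)
    show ?thesis
      unfolding recurrent_iff_not_transient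
      using recurrent_seq_if_not_transient[OF _ h(1) b] not_transient_if_recurrent_seq[OF h(1)] by blast
  qed
  show ?thesis
    unfolding I_def[symmetric] Occ_def[symmetric]
    using i recurrent_iff_not_transient iii iv v vi vii by blast
qed

end
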